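(* Let $M\in\mathbb N$ and $\mathcal A\subset\{0,\dots,M-1\}$ with $1<|\mathcal A|<M$. Let $\chi,\chi'\in C_0^\infty((0,1);[0,1])$ satisfy $\chi=\chi'$ in a neighborhood of the limiting Cantor set $\mathcal C_\infty$. Fix $\nu\ge0$. Then there exist constants $C_n$, $n\in\mathbb N$, depending only on $\chi,\chi',\nu$ (and on the fixed $M,\mathcal A$), such that for every $k\in\mathbb N$, with $N=M^k$, and every eigenvalue $\lambda$ of $B_{N,\chi}$ with $|\lambda|\ge M^{-\nu}$, there exists $v\in\ell^2_N$ with $$\|v\|_{\ell^2_N}=1,\qquad \|(B_{N,\chi'}-\lambda)v\|_{\ell^2_N}\le C_nN^{-n}\quad\text{for all }n\in\mathbb N.$$ (That is, $v$ is an $\mathcal O(N^{-\infty})$ quasimode for $B_{N,\chi'}$ at $\lambda$.)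
   Context: $\mathbb Z_N=\mathbb Z/N\mathbb Z\simeq\{0,\dots,N-1\}$; $\ell^2_N$ is the space of functions $u:\mathbb Z_N\to\mathbb C$ with $\|u\|_{\ell^2_N}^2=\sum_{j=0}^{N-1}|u(j)|^2$. The unitary Fourier transform is $\mathcal F_Nu(j)=\frac1{\sqrt N}\sum_{\ell=0}^{N-1}\exp(-2\pi ij\ell/N)u(\ell)$. For $\chi\in C_0^\infty((0,1);[0,1])$ (extended by zero), $\chi_N$ is the multiplication operator on $\ell^2_N$ by $\chi_N(j)=\chi(j/N)$, $j\in\{0,\dots,N-1\}$. Open quantum baker's map: for $N=M^k$, $k\in\mathbb N$, and $a\in\{0,\dots,M-1\}$, let $\Pi_a:\ell^2_N\to\ell^2_{N/M}$, $\Pi_au(j)=u(j+aN/M)$ for $j\in\{0,\dots,N/M-1\}$. Then $$B_{N,\chi}=\sum_{a\in\mathcal A}\mathcal F_N^*\,\Pi_a^*\,\chi_{N/M}\,\mathcal F_{N/M}\,\chi_{N/M}\,\Pi_a:\ell^2_N\to\ell^2_N.$$ Cantor sets: $\mathcal C_k=\{\sum_{j=0}^{k-1}a_jM^j\mid a_0,\dots,a_{k-1}\in\mathcal A\}\subset\{0,\dots,M^k-1\}$ and $\mathcal C_\infty=\bigcap_k\bigcup_{j\in\mathcal C_k}\big[\frac j{M^k},\frac{j+1}{M^k}\big]\subset[0,1]$. *)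

theory Defs
  imports
    "HOL-Analysis.Analysis"
    "Jordan_Normal_Form.Schur_Decomposition"
begin

text \<open>
  A function on \<open>\<int>/N\<int>\<close>, identified with \<open>{0..<N}\<close>, is a complex vector in \<open>carrier_vec N\<close>, and a
  linear map between such spaces is its matrix in the standard basis. The lemmas below recover
  the pointwise action of each operator.
\<close>

unbundle no vec_syntax

definition l2_norm :: "complex vec \<Rightarrow> real" where
  "l2_norm u = L2_set (\<lambda>j. cmod (u $ j)) {0..<dim_vec u}"

definition fourier_mat :: "nat \<Rightarrow> complex mat" where
  "fourier_mat N = mat N N (\<lambda>(j, l).
     exp (- 2 * of_real pi * \<i> * of_nat j * of_nat l / of_nat N) / of_real (sqrt (real N)))"

definition cutoff_mat :: "(real \<Rightarrow> real) \<Rightarrow> nat \<Rightarrow> complex mat" where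
  "cutoff_mat \<chi> N = mat_diag N (\<lambda>j. of_real (\<chi> (real j / real N)))"

definition proj_mat :: "nat \<Rightarrow> nat \<Rightarrow> nat \<Rightarrow> complex mat" where
  "proj_mat M N a = mat (N div M) N (\<lambda>(j, l). if l = j + a * (N div M) then 1 else 0)"

definition baker_summand :: "nat \<Rightarrow> (real \<Rightarrow> real) \<Rightarrow> nat \<Rightarrow> nat \<Rightarrow> complex mat" where
  "baker_summand M \<chi> N a =
     mat_adjoint (fourier_mat N) * mat_adjoint (proj_mat M N a) * cutoff_mat \<chi> (N div M)
       * fourier_mat (N div M) * cutoff_mat \<chi> (N div M) * proj_mat M N a"

text \<open>
  The type of matrices is not a commutative monoid (the zero matrix depends on the dimension),
  so the sum over the alphabet is formed entrywise. Only \<open>N\<close> divisible by \<open>M\<close> are meaningful.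
\<close>

definition baker_map :: "nat \<Rightarrow> nat set \<Rightarrow> (real \<Rightarrow> real) \<Rightarrow> nat \<Rightarrow> complex mat" where
  "baker_map M \<A> \<chi> N = mat N N (\<lambda>(i, j). \<Sum>a\<in>\<A>. baker_summand M \<chi> N a $$ (i, j))"

definition cantor_digits :: "nat \<Rightarrow> nat set \<Rightarrow> nat \<Rightarrow> nat set" where
  "cantor_digits M \<A> k = {\<Sum>j<k. a j * M ^ j | a. \<forall>j<k. a j \<in> \<A>}"

definition cantor_limit :: "nat \<Rightarrow> nat set \<Rightarrow> real set" where
  "cantor_limit M \<A> =
     (\<Inter>k. \<Union>j\<in>cantor_digits M \<A> k. {real j / real M ^ k .. (real j + 1) / real M ^ k})"

text \<open>
  The class \<open>C\<^sub>0\<^sup>\<infinity>((0,1);[0,1])\<close>, elements being extended by zero to the whole line.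
\<close>

definition cutoff_function :: "(real \<Rightarrow> real) \<Rightarrow> bool" where
  "cutoff_function \<chi> \<longleftrightarrow>
     (\<forall>n. (deriv ^^ n) \<chi> differentiable_on UNIV) \<and>
     compact (closure {x. \<chi> x \<noteq> 0}) \<and> closure {x. \<chi> x \<noteq> 0} \<subseteq> {0<..<1} \<and>
     range \<chi> \<subseteq> {0..1}"

lemma l2_norm_square:
  assumes "u \<in> carrier_vec N"
  shows "(l2_norm u)\<^sup>2 = (\<Sum>j = 0..<N. (cmod (u $ j))\<^sup>2)"
  using assms by (auto simp: l2_norm_def L2_set_def sum_nonneg)

lemma fourier_mat_carrier [simp]: "fourier_mat N \<in> carrier_mat N N"
  by (simp add: fourier_mat_def)

lemma cutoff_mat_carrier [simp]: "cutoff_mat \<chi> N \<in> carrier_mat N N"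
  by (simp add: cutoff_mat_def)

lemma proj_mat_carrier [simp]: "proj_mat M N a \<in> carrier_mat (N div M) N"
  by (simp add: proj_mat_def)

lemma baker_map_carrier [simp]: "baker_map M \<A> \<chi> N \<in> carrier_mat N N"
  by (simp add: baker_map_def)

lemma mat_adjoint_carrier [simp]: "A \<in> carrier_mat n m \<Longrightarrow> mat_adjoint A \<in> carrier_mat m n"
  by (auto simp: mat_adjoint_def mat_of_rows_def)

lemma index_mat_adjoint:
  assumes "A \<in> carrier_mat n m" "i < m" "j < n"
  shows "mat_adjoint A $$ (i, j) = conjugate (A $$ (j, i))"
  using assms by (auto simp: mat_adjoint_def mat_of_rows_def)

lemma baker_summand_carrier [simp]: "baker_summand M \<chi> N a \<in> carrier_mat N N"
  unfolding baker_summand_def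
  by (meson fourier_mat_carrier cutoff_mat_carrier proj_mat_carrier mat_adjoint_carrier
      mult_carrier_mat)

lemma fourier_mat_apply:
  assumes "u \<in> carrier_vec N" "j < N"
  shows "(fourier_mat N *\<^sub>v u) $ j = 1 / of_real (sqrt (real N)) *
     (\<Sum>l = 0..<N. exp (- 2 * of_real pi * \<i> * of_nat j * of_nat l / of_nat N) * u $ l)"
  using assms by (simp add: fourier_mat_def scalar_prod_def sum_divide_distrib)

lemma cutoff_mat_apply:
  assumes "u \<in> carrier_vec N" "j < N"
  shows "(cutoff_mat \<chi> N *\<^sub>v u) $ j = of_real (\<chi> (real j / real N)) * u $ j"
  using assms by (simp add: cutoff_mat_def mat_diag_def scalar_prod_def if_distrib[of "\<lambda>c. c * _"]
      sum.delta cong: if_cong)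

lemma proj_mat_apply:
  assumes "u \<in> carrier_vec N" "M dvd N" "a < M" "j < N div M"
  shows "(proj_mat M N a *\<^sub>v u) $ j = u $ (j + a * (N div M))"
proof -
  have "j + a * (N div M) < Suc a * (N div M)"
    using assms(4) by simp
  also have "\<dots> \<le> M * (N div M)"
    using assms(3) by (intro mult_le_mono) auto
  finally have "j + a * (N div M) < N"
    using assms(2) by simp
  then show ?thesis
    using assms by (simp add: proj_mat_def scalar_prod_def if_distrib[of "\<lambda>c. c * _"]
        sum.delta cong: if_cong)
qed

lemma baker_map_apply:
  assumes "u \<in> carrier_vec N" "j < N"
  shows "(baker_map M \<A> \<chi> N *\<^sub>v u) $ j = (\<Sum>a\<in>\<A>. (baker_summand M \<chi> N a *\<^sub>v u) $ j)"
proof -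
  have "(baker_summand M \<chi> N a *\<^sub>v u) $ j = (\<Sum>l = 0..<N. baker_summand M \<chi> N a $$ (j, l) * u $ l)"
    for a
    using assms carrier_matD[OF baker_summand_carrier[of M \<chi> N a]] by (simp add: scalar_prod_def)
  then show ?thesis
    using assms by (simp add: baker_map_def scalar_prod_def sum_distrib_right)
      (rule sum.swap)
qed

end

theory Submission
  imports Defs
begin

text \<open>
  The baker's map uses its cutoff twice: write \<open>B(\<alpha>, \<beta>)\<close> for the operator whose factor after
  \<open>\<F>\<close> on \<open>\<ell>\<^sup>2\<close> of the smaller torus is \<open>\<alpha>\<close> (a cutoff in frequency) and whose factor before it
  is \<open>\<beta>\<close> (a cutoff in position), so that \<open>B(\<chi>, \<chi>)\<close> is the map of the theorem. The two cutoffs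
  are replaced one at a time.

  Replacing the frequency cutoff is easy, because one step of \<open>B\<close> moves frequencies by the
  contractions \<open>\<xi> \<mapsto> (a + \<xi>) / M\<close> with \<open>a \<in> \<A>\<close>. A quasimode \<open>u\<close> with eigenvalue \<open>\<mu>\<close>
  bounded away from \<open>0\<close> satisfies \<open>u = \<mu>\<^sup>-\<^sup>1 B u\<close> up to a small error, and iterating this a fixed
  number \<open>m\<close> of times concentrates its frequencies, up to \<open>O(N\<^sup>-\<^sup>\<infinity>)\<close>, near the \<open>m\<close>-th stage of the
  Cantor set (\<open>quasimode_localization\<close>). For large \<open>m\<close> this stage lies well inside the set where
  the two cutoffs agree, so the very same \<open>u\<close> is a quasimode for both (\<open>outer_cutoff_change\<close>).
  The only analysis is that matrix entries between frequencies that are not related by the dynamics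
  are \<open>O(N\<^sup>-\<^sup>\<infinity>)\<close> (\<open>frequency_baker_off_diagonal_decay\<close>), a discrete nonstationary phase
  estimate (\<open>oscillatory_sum_bound\<close>).

  The position cutoff cannot be treated like this, as quasimodes are not localized in position.
  But the transpose of \<open>B(\<alpha>, \<beta>)\<close> is unitarily equivalent, through \<open>\<F>\<^sub>N\<close>, to \<open>B(\<beta>, \<alpha>)\<close>,
  which has the two roles exchanged (\<open>fourier_intertwines_transpose\<close>); and a square matrix and its
  transpose have the same smallest singular value, so a quasimode of one yields a quasimode of the
  other at the same \<open>\<mu>\<close> and with no larger error (\<open>transpose_quasimode\<close>). The proof therefore goes
  from \<open>B(\<chi>, \<chi>)\<close> to \<open>B(\<chi>', \<chi>)\<close> with the same vector, to \<open>B(\<chi>, \<chi>')\<close> by transposition, and to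
  \<open>B(\<chi>', \<chi>')\<close> with the same vector again.
\<close>

\<comment> \<open>The dot is the bilinear scalar product of vectors throughout, not the real inner product.\<close>
unbundle no inner_syntax

section \<open>Vectors and quasimodes of the transpose\<close>

lemma l2_norm_nonneg: "0 \<le> l2_norm u"
  by (simp add: l2_norm_def)

lemma l2_norm_smult: "l2_norm (c \<cdot>\<^sub>v u) = cmod c * l2_norm u"
proof -
  have "l2_norm (c \<cdot>\<^sub>v u) = L2_set (\<lambda>j. cmod c * cmod (u $ j)) {0..<dim_vec u}"
    unfolding l2_norm_def by (intro L2_set_cong) (auto simp: norm_mult)
  then show ?thesis
    by (simp add: l2_norm_def L2_set_right_distrib)
qed

lemma l2_norm_eq_0_iff:
  assumes "u \<in> carrier_vec N"
  shows "l2_norm u = 0 \<longleftrightarrow> u = 0\<^sub>v N"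
  using assms by (auto simp: l2_norm_def L2_set_eq_0_iff intro!: eq_vecI)

lemma exists_unit_vector_on_line:
  assumes "u \<in> carrier_vec N" "u \<noteq> 0\<^sub>v N"
  obtains c where "c \<noteq> 0" "l2_norm (c \<cdot>\<^sub>v u) = 1"
proof -
  have "l2_norm u > 0"
    using assms l2_norm_eq_0_iff l2_norm_nonneg by (metis order_le_less)
  then show ?thesis
    by (intro that[of "of_real (1 / l2_norm u)"]) (auto simp: l2_norm_smult norm_divide)
qed

lemma cmod_index_le_l2_norm:
  assumes "u \<in> carrier_vec N" "j < N"
  shows "cmod (u $ j) \<le> l2_norm u"
  using assms by (auto simp: l2_norm_def intro!: member_le_L2_set)

lemma l2_norm_le_sup:
  assumes "u \<in> carrier_vec N" "\<And>j. j < N \<Longrightarrow> cmod (u $ j) \<le> b"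
  shows "l2_norm u \<le> real N * b"
proof -
  have "l2_norm u \<le> (\<Sum>j\<in>{0..<N}. cmod (u $ j))"
    using assms by (auto simp: l2_norm_def intro!: L2_set_le_sum)
  also have "\<dots> \<le> (\<Sum>j\<in>{0..<N}. b)"
    using assms by (intro sum_mono) auto
  finally show ?thesis by simp
qed

lemma l2_norm_conjugate [simp]: "l2_norm (conjugate u) = l2_norm u"
  unfolding l2_norm_def by (auto intro!: L2_set_cong)

lemma cauchy_schwarz_vec:
  assumes "u \<in> carrier_vec N" "w \<in> carrier_vec N"
  shows "cmod (u \<bullet> w) \<le> l2_norm u * l2_norm w"
proof -
  have "cmod (u \<bullet> w) \<le> (\<Sum>j\<in>{0..<N}. \<bar>cmod (u $ j)\<bar> * \<bar>cmod (w $ j)\<bar>)"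
    using assms unfolding scalar_prod_def by (intro order.trans[OF norm_sum]) (simp add: norm_mult)
  also have "\<dots> \<le> l2_norm u * l2_norm w"
    using assms L2_set_mult_ineq[of "\<lambda>j. cmod (u $ j)" "\<lambda>j. cmod (w $ j)" "{0..<N}"]
    by (auto simp: l2_norm_def)
  finally show ?thesis .
qed

lemma l2_norm_square_scalar_prod:
  assumes "u \<in> carrier_vec N"
  shows "u \<bullet>c u = of_real ((l2_norm u)\<^sup>2)"
  using assms l2_norm_square[OF assms]
  by (simp add: scalar_prod_def complex_norm_square del: of_real_power)

text \<open>
  A lower bound \<open>\<parallel>A\<^sup>T v\<parallel> > \<epsilon> \<parallel>v\<parallel>\<close> for all \<open>v \<noteq> 0\<close> would allow solving \<open>A\<^sup>T v = conjugate u\<close>, and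
  then \<open>1 = u \<bullet> A\<^sup>T v = A u \<bullet> v \<le> \<parallel>A u\<parallel> \<parallel>v\<parallel>\<close> bounds \<open>\<parallel>A u\<parallel>\<close> from below. Thus either the
  transpose is singular, or this solution \<open>v\<close>, normalized, is as good for the transpose as \<open>u\<close> is
  for \<open>A\<close>.
\<close>
lemma transpose_almost_kernel:
  assumes A: "A \<in> carrier_mat N N" and u: "u \<in> carrier_vec N" "l2_norm u = 1"
  obtains v where "v \<in> carrier_vec N" "l2_norm v = 1"
    "l2_norm (transpose_mat A *\<^sub>v v) \<le> l2_norm (A *\<^sub>v u)"
proof -
  let ?T = "transpose_mat A"
  have T: "?T \<in> carrier_mat N N" using A by simp
  have "\<exists>v\<in>carrier_vec N. v \<noteq> 0\<^sub>v N \<and> l2_norm (?T *\<^sub>v v) \<le> l2_norm (A *\<^sub>v u) * l2_norm v"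
  proof (cases "det ?T = 0")
    case True
    then obtain v where "v \<in> carrier_vec N" "v \<noteq> 0\<^sub>v N" "?T *\<^sub>v v = 0\<^sub>v N"
      using det_0_iff_vec_prod_zero_field[OF T] by auto
    moreover have "l2_norm (0\<^sub>v N) = 0"
      by (simp add: l2_norm_eq_0_iff[of _ N])
    ultimately show ?thesis
      by (intro bexI[of _ v]) (auto simp: l2_norm_nonneg)
  next
    case False
    define v where "v = (1 / Determinant.det ?T) \<cdot>\<^sub>v (adj_mat ?T *\<^sub>v conjugate u)"
    have adj: "adj_mat ?T \<in> carrier_mat N N" "?T * adj_mat ?T = Determinant.det ?T \<cdot>\<^sub>m 1\<^sub>m N"
      using adj_mat[OF T] by auto
    have v: "v \<in> carrier_vec N"
      unfolding v_def using adj u by auto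
    have cu: "conjugate u \<in> carrier_vec N" using u by simp
    have "?T *\<^sub>v v = (1 / Determinant.det ?T) \<cdot>\<^sub>v (?T *\<^sub>v (adj_mat ?T *\<^sub>v conjugate u))"
      unfolding v_def using adj cu T by (intro mult_mat_vec) auto
    also have "?T *\<^sub>v (adj_mat ?T *\<^sub>v conjugate u) = (?T * adj_mat ?T) *\<^sub>v conjugate u"
      by (rule assoc_mult_mat_vec[OF T adj(1) cu, symmetric])
    also have "\<dots> = Determinant.det ?T \<cdot>\<^sub>v conjugate u"
      unfolding adj(2) using cu u(1) by (intro eq_vecI) auto
    finally have Tv: "?T *\<^sub>v v = conjugate u"
      using False by (simp add: smult_smult_assoc)
    have "1 = cmod (u \<bullet>c u)"
      using l2_norm_square_scalar_prod[OF u(1)] u(2) by simp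
    also have "u \<bullet>c u = (?T *\<^sub>v v) \<bullet> u"
      using Tv u cu by (simp add: comm_scalar_prod[of _ N])
    also have "\<dots> = v \<bullet> (A *\<^sub>v u)"
      by (rule transpose_vec_mult_scalar[OF A u(1) v])
    also have "cmod \<dots> \<le> l2_norm v * l2_norm (A *\<^sub>v u)"
      using A u v by (intro cauchy_schwarz_vec[of _ N]) auto
    finally have le: "1 \<le> l2_norm (A *\<^sub>v u) * l2_norm v"
      by (simp add: mult.commute)
    have "v \<noteq> 0\<^sub>v N"
      using le l2_norm_eq_0_iff[OF v] by auto
    then show ?thesis
      using v le Tv u by (intro bexI[of _ v]) auto
  qed
  then obtain v where v: "v \<in> carrier_vec N" "v \<noteq> 0\<^sub>v N"
    and le: "l2_norm (?T *\<^sub>v v) \<le> l2_norm (A *\<^sub>v u) * l2_norm v" by auto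
  obtain c where c: "c \<noteq> 0" "l2_norm (c \<cdot>\<^sub>v v) = 1"
    using exists_unit_vector_on_line[OF v] .
  have "l2_norm (?T *\<^sub>v (c \<cdot>\<^sub>v v)) = cmod c * l2_norm (?T *\<^sub>v v)"
    using T v by (simp add: mult_mat_vec[OF T] l2_norm_smult)
  also have "\<dots> \<le> cmod c * (l2_norm (A *\<^sub>v u) * l2_norm v)"
    using le by (intro mult_left_mono) auto
  also have "\<dots> = l2_norm (A *\<^sub>v u)"
    using c by (simp add: l2_norm_smult)
  finally show ?thesis
    using that[of "c \<cdot>\<^sub>v v"] c v by auto
qed

lemma residual_carrier:
  assumes "u \<in> carrier_vec N"
  shows "A *\<^sub>v u - \<mu> \<cdot>\<^sub>v u \<in> carrier_vec N"
  using assms by (intro carrier_vecI) simp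

lemma residual_eq:
  fixes A :: "complex mat"
  assumes "A \<in> carrier_mat N N" "u \<in> carrier_vec N"
  shows "(A - \<mu> \<cdot>\<^sub>m 1\<^sub>m N) *\<^sub>v u = A *\<^sub>v u - \<mu> \<cdot>\<^sub>v u"
proof -
  have "(\<mu> \<cdot>\<^sub>m 1\<^sub>m N) *\<^sub>v u = \<mu> \<cdot>\<^sub>v u"
    using assms by (intro eq_vecI) auto
  then show ?thesis
    using minus_mult_distrib_mat_vec[of A N N "\<mu> \<cdot>\<^sub>m 1\<^sub>m N" u] assms by simp
qed

text \<open>
  Applied with the eigenvalue of a matrix, this makes the existence of quasimodes invariant under
  transposition.
\<close>
lemma transpose_quasimode:
  fixes A :: "complex mat"
  assumes A: "A \<in> carrier_mat N N" and u: "u \<in> carrier_vec N" "l2_norm u = 1"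
  obtains v where "v \<in> carrier_vec N" "l2_norm v = 1"
    "l2_norm (transpose_mat A *\<^sub>v v - \<mu> \<cdot>\<^sub>v v) \<le> l2_norm (A *\<^sub>v u - \<mu> \<cdot>\<^sub>v u)"
proof -
  let ?B = "A - \<mu> \<cdot>\<^sub>m 1\<^sub>m N"
  have "?B \<in> carrier_mat N N"
    by (intro minus_carrier_mat smult_carrier_mat one_carrier_mat)
  then obtain v where v: "v \<in> carrier_vec N" "l2_norm v = 1"
    "l2_norm (transpose_mat ?B *\<^sub>v v) \<le> l2_norm (?B *\<^sub>v u)"
    by (rule transpose_almost_kernel[OF _ u])
  have "transpose_mat ?B = transpose_mat A - \<mu> \<cdot>\<^sub>m 1\<^sub>m N"
    using A by (intro eq_matI) auto
  then show ?thesis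
    using that[OF v(1,2)] v(3) residual_eq[OF A u(1), of \<mu>]
      residual_eq[of "transpose_mat A" N v \<mu>] A v(1) by simp
qed

section \<open>The discrete Fourier transform\<close>

text \<open>
  The geometric sum behind the orthogonality of the characters of \<open>\<int>/N\<int>\<close>.
\<close>
lemma sum_cis_roots_of_unity:
  fixes r :: int
  assumes "N > 0" "\<not> int N dvd r"
  shows "(\<Sum>l<N. exp (2 * of_real pi * \<i> * of_int r / of_nat N) ^ l) = 0"
proof -
  let ?z = "exp (2 * of_real pi * \<i> * of_int r / of_nat N)"
  have "?z \<noteq> 1"
  proof
    assume "?z = 1"
    then obtain n :: int where "2 * pi * real_of_int r / real N = of_int (2 * n) * pi"
      by (auto simp: exp_eq_1)
    then have "real_of_int r = real_of_int (int N * n)"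
      using assms by (simp add: field_simps)
    then have "r = int N * n" by linarith
    then show False using assms by auto
  qed
  moreover have "?z ^ N = 1"
  proof -
    have "?z ^ N = exp (of_nat N * (2 * of_real pi * \<i> * of_int r / of_nat N))"
      by (rule exp_of_nat_mult[symmetric])
    also have "\<dots> = exp (2 * of_real pi * \<i> * of_int r)"
      using assms by simp
    also have "\<dots> = 1" by (auto simp: exp_eq_1)
    finally show ?thesis .
  qed
  ultimately show ?thesis
    by (simp add: geometric_sum)
qed

abbreviation "fourier_adj N \<equiv> mat_adjoint (fourier_mat N)"

lemma fourier_mat_dim [simp]:
  "dim_row (fourier_mat N) = N" "dim_col (fourier_mat N) = N"
  "dim_row (fourier_adj N) = N" "dim_col (fourier_adj N) = N"
  using carrier_matD[OF mat_adjoint_carrier[OF fourier_mat_carrier[of N]]]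
  by (auto simp: fourier_mat_def)

lemma fourier_mat_index:
  assumes "i < N" "j < N"
  shows "fourier_mat N $$ (i, j) =
    exp (- 2 * of_real pi * \<i> * of_nat i * of_nat j / of_nat N) / of_real (sqrt (real N))"
  using assms by (simp add: fourier_mat_def)

lemma fourier_adj_index:
  assumes "i < N" "j < N"
  shows "fourier_adj N $$ (i, j) =
    exp (2 * of_real pi * \<i> * of_nat i * of_nat j / of_nat N) / of_real (sqrt (real N))"
  using assms by (subst index_mat_adjoint[of _ N N])
    (auto simp: fourier_mat_def exp_cnj mult_ac)

lemma transpose_fourier_mat: "transpose_mat (fourier_mat N) = fourier_mat N"
  by (auto simp: fourier_mat_def mult_ac)

lemma transpose_fourier_adj: "transpose_mat (fourier_adj N) = fourier_adj N"
  by (rule eq_matI) (auto simp: fourier_adj_index mult_ac)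

lemma fourier_unitary_aux:
  assumes "N > 0" "i < N" "j < N"
  shows "(\<Sum>l\<in>{0..<N}. exp (2 * of_real pi * \<i> * of_nat i * of_nat l / of_nat N) *
       exp (- 2 * of_real pi * \<i> * of_nat l * of_nat j / of_nat N)) = (if i = j then of_nat N else 0)"
proof -
  let ?r = "int i - int j"
  have *: "exp (2 * of_real pi * \<i> * of_nat i * of_nat l / of_nat N) *
       exp (- 2 * of_real pi * \<i> * of_nat l * of_nat j / of_nat N)
     = exp (2 * of_real pi * \<i> * of_int ?r / of_nat N) ^ l" for l
    unfolding exp_of_nat_mult[symmetric] mult_exp_exp
    by (rule arg_cong[of _ _ exp]) (simp add: field_simps diff_divide_distrib)
  show ?thesis
  proof (cases "i = j")
    case True
    then show ?thesis unfolding * by simp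
  next
    case False
    have "\<not> int N dvd ?r"
      using assms False zdvd_imp_le[of "int N" "\<bar>?r\<bar>"] by auto
    then show ?thesis
      using False sum_cis_roots_of_unity[of N ?r] assms unfolding * by (simp add: atLeast0LessThan)
  qed
qed

lemma fourier_adj_mult_fourier: "fourier_adj N * fourier_mat N = 1\<^sub>m N"
proof (rule eq_matI)
  fix i j assume ij: "i < dim_row (1\<^sub>m N :: complex mat)" "j < dim_col (1\<^sub>m N :: complex mat)"
  then have N: "N > 0" by auto
  have s: "complex_of_real (sqrt (real N)) * of_real (sqrt (real N)) = of_nat N"
    unfolding of_real_mult[symmetric] by simp
  have "(fourier_adj N * fourier_mat N) $$ (i, j)
     = (\<Sum>l\<in>{0..<N}. fourier_adj N $$ (i, l) * fourier_mat N $$ (l, j))"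
    using ij by (simp add: scalar_prod_def)
  also have "\<dots> = (\<Sum>l\<in>{0..<N}. exp (2 * of_real pi * \<i> * of_nat i * of_nat l / of_nat N) *
       exp (- 2 * of_real pi * \<i> * of_nat l * of_nat j / of_nat N) / of_nat N)"
  proof (intro sum.cong refl)
    fix l assume "l \<in> {0..<N}"
    then show "fourier_adj N $$ (i, l) * fourier_mat N $$ (l, j) =
        exp (2 * of_real pi * \<i> * of_nat i * of_nat l / of_nat N) *
        exp (- 2 * of_real pi * \<i> * of_nat l * of_nat j / of_nat N) / of_nat N"
      using ij s by (subst fourier_adj_index) (auto simp: fourier_mat_def)
  qed
  also have "\<dots> = (if i = j then 1 else 0)"
    using fourier_unitary_aux[of N i j] ij N unfolding sum_divide_distrib[symmetric] by simp
  finally show "(fourier_adj N * fourier_mat N) $$ (i, j) = 1\<^sub>m N $$ (i, j)"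
    using ij by simp
qed auto

lemma fourier_mult_fourier_adj: "fourier_mat N * fourier_adj N = 1\<^sub>m N"
  using fourier_adj_mult_fourier mat_mult_left_right_inverse[of "fourier_adj N" N "fourier_mat N"]
  by simp

lemma conjugate_fourier_mult:
  assumes "u \<in> carrier_vec N"
  shows "conjugate (fourier_mat N *\<^sub>v u) = fourier_adj N *\<^sub>v conjugate u"
proof (rule eq_vecI)
  fix i assume "i < dim_vec (fourier_adj N *\<^sub>v conjugate u)"
  then have i: "i < N" by simp
  show "conjugate (fourier_mat N *\<^sub>v u) $ i = (fourier_adj N *\<^sub>v conjugate u) $ i"
    using i assms
    by (auto simp: scalar_prod_def fourier_adj_index fourier_mat_index exp_cnj mult_ac intro!: sum.cong)
qed simp

text \<open>
  The scalar product here is bilinear, so unitarity is used in the form: \<open>\<F>\<close> is symmetric, and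
  complex conjugation turns it into its inverse.
\<close>
lemma l2_norm_fourier:
  assumes "u \<in> carrier_vec N"
  shows "l2_norm (fourier_mat N *\<^sub>v u) = l2_norm u"
proof -
  have Fu: "fourier_mat N *\<^sub>v u \<in> carrier_vec N"
    using assms by (intro mult_mat_vec_carrier[of _ N N]) auto
  have "(fourier_mat N *\<^sub>v u) \<bullet>c (fourier_mat N *\<^sub>v u)
      = (transpose_mat (fourier_mat N) *\<^sub>v u) \<bullet> (fourier_adj N *\<^sub>v conjugate u)"
    by (simp add: transpose_fourier_mat conjugate_fourier_mult[OF assms])
  also have "\<dots> = u \<bullet> (fourier_mat N *\<^sub>v (fourier_adj N *\<^sub>v conjugate u))"
    using assms by (intro transpose_vec_mult_scalar[of _ N N]) (auto intro!: mult_mat_vec_carrier)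
  also have "\<dots> = u \<bullet>c u"
    using assms by (simp add: assoc_mult_mat_vec[of _ N N _ N, symmetric] fourier_mult_fourier_adj)
  finally have "(l2_norm (fourier_mat N *\<^sub>v u))\<^sup>2 = (l2_norm u)\<^sup>2"
    unfolding l2_norm_square_scalar_prod[OF assms] l2_norm_square_scalar_prod[OF Fu]
    by (metis of_real_eq_iff)
  then show ?thesis
    using l2_norm_nonneg by simp
qed

section \<open>The baker's map in the frequency representation\<close>

text \<open>
  This is \<open>\<Sum>a\<in>\<A>. \<Pi>\<^sub>a\<^sup>* \<alpha> \<F> \<beta> \<Pi>\<^sub>a\<close> on \<open>\<ell>\<^sup>2\<close> with \<open>N = M * n\<close>: the index \<open>p + a * n\<close> stands for
  the entry \<open>p\<close> of the block of the letter \<open>a\<close>, and each block with \<open>a \<in> \<A>\<close> carries a truncated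
  Fourier transform of size \<open>n\<close>. The two cutoffs are independent parameters, because the proof
  changes them separately.
\<close>
definition block_fourier_mat :: "nat \<Rightarrow> nat set \<Rightarrow> (real \<Rightarrow> real) \<Rightarrow> (real \<Rightarrow> real) \<Rightarrow> nat \<Rightarrow> complex mat" where
  "block_fourier_mat M \<A> \<alpha> \<beta> n = mat (M * n) (M * n) (\<lambda>(i, j).
     if i div n = j div n \<and> i div n \<in> \<A>
     then of_real (\<alpha> (real (i mod n) / real n)) * fourier_mat n $$ (i mod n, j mod n)
            * of_real (\<beta> (real (j mod n) / real n))
     else 0)"

text \<open>
  This is \<open>\<F>\<^sub>N B(\<alpha>, \<beta>) \<F>\<^sub>N\<^sup>*\<close>. In this representation the frequency cutoff \<open>\<alpha>\<close> multiplies the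
  rows of the matrix, so that changing it changes no row on which the two choices agree.
\<close>
definition frequency_baker :: "nat \<Rightarrow> nat set \<Rightarrow> (real \<Rightarrow> real) \<Rightarrow> (real \<Rightarrow> real) \<Rightarrow> nat \<Rightarrow> complex mat" where
  "frequency_baker M \<A> \<alpha> \<beta> n = block_fourier_mat M \<A> \<alpha> \<beta> n * fourier_adj (M * n)"

lemma block_fourier_mat_carrier [simp]: "block_fourier_mat M \<A> \<alpha> \<beta> n \<in> carrier_mat (M * n) (M * n)"
  by (simp add: block_fourier_mat_def)

lemma frequency_baker_carrier [simp]: "frequency_baker M \<A> \<alpha> \<beta> n \<in> carrier_mat (M * n) (M * n)"
  unfolding frequency_baker_def by (intro mult_carrier_mat[of _ _ "M * n"]) auto

text \<open>
  Exchange of the cutoffs under transposition, from the symmetry of the Fourier matrix.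
\<close>
lemma transpose_block_fourier_mat:
  assumes "n > 0"
  shows "transpose_mat (block_fourier_mat M \<A> \<alpha> \<beta> n) = block_fourier_mat M \<A> \<beta> \<alpha> n"
proof (rule eq_matI)
  fix i j assume "i < dim_row (block_fourier_mat M \<A> \<beta> \<alpha> n)" "j < dim_col (block_fourier_mat M \<A> \<beta> \<alpha> n)"
  then have ij: "i < M * n" "j < M * n" by (auto simp: block_fourier_mat_def)
  have "fourier_mat n $$ (i mod n, j mod n) = fourier_mat n $$ (j mod n, i mod n)"
    using assms by (subst transpose_fourier_mat[symmetric]) simp
  then show "transpose_mat (block_fourier_mat M \<A> \<alpha> \<beta> n) $$ (i, j) = block_fourier_mat M \<A> \<beta> \<alpha> n $$ (i, j)"
    using ij by (auto simp: block_fourier_mat_def mult_ac)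
qed (auto simp: block_fourier_mat_def)

lemma fourier_frequency_baker_transpose:
  assumes "n > 0"
  shows "fourier_mat (M * n) * transpose_mat (frequency_baker M \<A> \<alpha> \<beta> n)
    = block_fourier_mat M \<A> \<beta> \<alpha> n"
proof -
  let ?F = "fourier_mat (M * n)" and ?F' = "fourier_adj (M * n)" and ?H = "block_fourier_mat M \<A> \<beta> \<alpha> n"
  have "transpose_mat (frequency_baker M \<A> \<alpha> \<beta> n) = ?F' * ?H"
    unfolding frequency_baker_def
    by (subst transpose_mult[of _ "M * n" "M * n" _ "M * n"])
      (simp_all add: transpose_fourier_adj transpose_block_fourier_mat[OF assms])
  then have "?F * transpose_mat (frequency_baker M \<A> \<alpha> \<beta> n) = (?F * ?F') * ?H"
    by (simp add: assoc_mult_mat[of _ "M * n" "M * n" _ "M * n" _ "M * n"])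
  then show ?thesis
    unfolding fourier_mult_fourier_adj left_mult_one_mat[OF block_fourier_mat_carrier] .
qed

lemma proj_index_iff:
  fixes n :: nat
  assumes "j < n"
  shows "i = j + a * n \<longleftrightarrow> i div n = a \<and> j = i mod n"
  using assms by auto

lemma proj_conjugation_index:
  assumes X: "X \<in> carrier_mat n n" and n: "n > 0" "M > 0" and ij: "i < M * n" "j < M * n"
  shows "(mat_adjoint (proj_mat M (M * n) a) * X * proj_mat M (M * n) a) $$ (i, j)
    = (if i div n = a \<and> j div n = a then X $$ (i mod n, j mod n) else 0)"
proof -
  let ?P = "proj_mat M (M * n) a"
  have P: "?P \<in> carrier_mat n (M * n)"
    using proj_mat_carrier[of M "M * n" a] n by simp
  have PI: "?P $$ (l, i) = (if i div n = a \<and> l = i mod n then 1 else 0)" if "l < n" "i < M * n" for l i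
    using that n proj_index_iff[of l n i a] by (simp add: proj_mat_def)
  have PX: "(mat_adjoint ?P * X) $$ (i, l) = (if i div n = a then X $$ (i mod n, l) else 0)" if l: "l < n" for l
  proof -
    have "(mat_adjoint ?P * X) $$ (i, l) = (\<Sum>s\<in>{0..<n}. mat_adjoint ?P $$ (i, s) * X $$ (s, l))"
      using ij l X P carrier_matD[OF mat_adjoint_carrier[OF P]] by (simp add: scalar_prod_def)
    also have "\<dots> = (\<Sum>s\<in>{0..<n}. if s = i mod n then (if i div n = a then X $$ (s, l) else 0) else 0)"
      using ij by (intro sum.cong) (auto simp: index_mat_adjoint[OF P] PI)
    finally show ?thesis using n by simp
  qed
  have PXc: "mat_adjoint ?P * X \<in> carrier_mat (M * n) n"
    using P X by (intro mult_carrier_mat[of _ _ n]) auto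
  have "(mat_adjoint ?P * X * ?P) $$ (i, j) = (\<Sum>l\<in>{0..<n}. (mat_adjoint ?P * X) $$ (i, l) * ?P $$ (l, j))"
    using ij P carrier_matD[OF PXc] by (simp add: scalar_prod_def)
  also have "\<dots> = (\<Sum>l\<in>{0..<n}. if l = j mod n then
      (if i div n = a \<and> j div n = a then X $$ (i mod n, l) else 0) else 0)"
    using ij by (intro sum.cong) (auto simp: PX PI)
  finally show ?thesis using n by simp
qed

lemma baker_map_eq:
  assumes n: "n > 0" "M > 0" and fin: "finite \<A>"
  shows "baker_map M \<A> \<chi> (M * n) = fourier_adj (M * n) * block_fourier_mat M \<A> \<chi> \<chi> n"
proof -
  let ?N = "M * n"
  let ?F' = "fourier_adj ?N"
  define X where "X = cutoff_mat \<chi> n * fourier_mat n * cutoff_mat \<chi> n"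
  define S where "S a = mat_adjoint (proj_mat M ?N a) * X * proj_mat M ?N a" for a
  have N: "?N div M = n" using n by simp
  have P: "proj_mat M ?N a \<in> carrier_mat n ?N" for a
    using proj_mat_carrier[of M ?N a] N by simp
  have X: "X \<in> carrier_mat n n"
    unfolding X_def by (intro mult_carrier_mat[of _ n n]) auto
  have S: "S a \<in> carrier_mat ?N ?N" for a
    unfolding S_def using P[of a] X by (intro mult_carrier_mat[of _ ?N n]) auto
  have XI: "X $$ (p, l) = of_real (\<chi> (real p / real n)) * fourier_mat n $$ (p, l) * of_real (\<chi> (real l / real n))"
    if "p < n" "l < n" for p l
    using that unfolding X_def cutoff_mat_def
    by (subst mat_diag_mult_right[of _ n n]) (auto simp: mat_diag_mult_left[of _ n n])
  have summand: "baker_summand M \<chi> ?N a = ?F' * S a" for a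
  proof -
    have c: "cutoff_mat \<chi> n \<in> carrier_mat n n" "fourier_mat n \<in> carrier_mat n n"
      "mat_adjoint (proj_mat M ?N a) \<in> carrier_mat ?N n" "?F' \<in> carrier_mat ?N ?N"
      using P[of a] by auto
    have 1: "?F' * mat_adjoint (proj_mat M ?N a) * cutoff_mat \<chi> n * fourier_mat n * cutoff_mat \<chi> n
        = ?F' * mat_adjoint (proj_mat M ?N a) * X"
      unfolding X_def using c
      by (smt (verit) assoc_mult_mat mult_carrier_mat)
    have 2: "?F' * mat_adjoint (proj_mat M ?N a) * X * proj_mat M ?N a = ?F' * S a"
      unfolding S_def using c P[of a] X
      by (smt (verit) assoc_mult_mat mult_carrier_mat)
    show ?thesis
      unfolding baker_summand_def N 1 2 ..
  qed
  show ?thesis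
  proof (rule eq_matI)
    fix i j assume "i < dim_row (?F' * block_fourier_mat M \<A> \<chi> \<chi> n)" "j < dim_col (?F' * block_fourier_mat M \<A> \<chi> \<chi> n)"
    then have ij: "i < ?N" "j < ?N" by (auto simp: block_fourier_mat_def)
    have H: "(\<Sum>a\<in>\<A>. S a $$ (l, j)) = block_fourier_mat M \<A> \<chi> \<chi> n $$ (l, j)" if l: "l < ?N" for l
    proof -
      have "(\<Sum>a\<in>\<A>. S a $$ (l, j)) =
          (\<Sum>a\<in>\<A>. if a = l div n then (if j div n = l div n then X $$ (l mod n, j mod n) else 0) else 0)"
        unfolding S_def by (intro sum.cong refl) (auto simp: proj_conjugation_index[OF X n l ij(2)])
      also have "\<dots> = block_fourier_mat M \<A> \<chi> \<chi> n $$ (l, j)"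
        using fin l ij n by (simp add: block_fourier_mat_def XI)
      finally show ?thesis .
    qed
    have "baker_map M \<A> \<chi> ?N $$ (i, j) = (\<Sum>a\<in>\<A>. \<Sum>l\<in>{0..<?N}. ?F' $$ (i, l) * S a $$ (l, j))"
      using ij carrier_matD[OF S] by (simp add: baker_map_def summand scalar_prod_def)
    also have "\<dots> = (\<Sum>l\<in>{0..<?N}. ?F' $$ (i, l) * block_fourier_mat M \<A> \<chi> \<chi> n $$ (l, j))"
      by (subst sum.swap) (intro sum.cong refl, simp add: sum_distrib_left[symmetric] H)
    also have "\<dots> = (?F' * block_fourier_mat M \<A> \<chi> \<chi> n) $$ (i, j)"
      using ij by (simp add: scalar_prod_def carrier_matD[OF block_fourier_mat_carrier])
    finally show "baker_map M \<A> \<chi> ?N $$ (i, j) = (?F' * block_fourier_mat M \<A> \<chi> \<chi> n) $$ (i, j)" .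
  qed (auto simp: baker_map_def block_fourier_mat_def)
qed

text \<open>
  The position representation of \<open>B(\<beta>, \<alpha>)\<close> is the transpose of the frequency representation of
  \<open>B(\<alpha>, \<beta>)\<close>, and the Fourier transform passes between the two representations isometrically.
\<close>
lemma fourier_intertwines_transpose:
  assumes n: "n > 0" and v: "v \<in> carrier_vec (M * n)"
  shows "l2_norm (frequency_baker M \<A> \<beta> \<alpha> n *\<^sub>v (fourier_mat (M * n) *\<^sub>v v) - \<mu> \<cdot>\<^sub>v (fourier_mat (M * n) *\<^sub>v v))
    = l2_norm (transpose_mat (frequency_baker M \<A> \<alpha> \<beta> n) *\<^sub>v v - \<mu> \<cdot>\<^sub>v v)"
proof -
  let ?F = "fourier_mat (M * n)" and ?F' = "fourier_adj (M * n)" and ?H = "block_fourier_mat M \<A> \<beta> \<alpha> n"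
    and ?T = "transpose_mat (frequency_baker M \<A> \<alpha> \<beta> n)"
  have T: "?T \<in> carrier_mat (M * n) (M * n)" by simp
  have Tv: "?T *\<^sub>v v \<in> carrier_vec (M * n)" "?T *\<^sub>v v - \<mu> \<cdot>\<^sub>v v \<in> carrier_vec (M * n)"
    using v mult_mat_vec_carrier[OF T v] by auto
  have Fv: "?F *\<^sub>v v \<in> carrier_vec (M * n)"
    using v by (intro mult_mat_vec_carrier[of _ "M * n" "M * n"]) auto
  have "frequency_baker M \<A> \<beta> \<alpha> n *\<^sub>v (?F *\<^sub>v v) = ?H *\<^sub>v (?F' *\<^sub>v (?F *\<^sub>v v))"
    unfolding frequency_baker_def by (rule assoc_mult_mat_vec[OF block_fourier_mat_carrier _ Fv]) simp
  also have "?F' *\<^sub>v (?F *\<^sub>v v) = (?F' * ?F) *\<^sub>v v"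
    by (rule assoc_mult_mat_vec[OF _ _ v, symmetric]) auto
  also have "\<dots> = v"
    using v by (simp add: fourier_adj_mult_fourier)
  also have "?H *\<^sub>v v = (?F * ?T) *\<^sub>v v"
    unfolding fourier_frequency_baker_transpose[OF n] ..
  also have "\<dots> = ?F *\<^sub>v (?T *\<^sub>v v)"
    by (rule assoc_mult_mat_vec[OF _ T v]) auto
  finally have "frequency_baker M \<A> \<beta> \<alpha> n *\<^sub>v (?F *\<^sub>v v) - \<mu> \<cdot>\<^sub>v (?F *\<^sub>v v) = ?F *\<^sub>v (?T *\<^sub>v v) - ?F *\<^sub>v (\<mu> \<cdot>\<^sub>v v)"
    using mult_mat_vec[OF fourier_mat_carrier v, of \<mu>] by simp
  also have "\<dots> = ?F *\<^sub>v (?T *\<^sub>v v - \<mu> \<cdot>\<^sub>v v)"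
    using v Tv by (intro mult_minus_distrib_mat_vec[symmetric, of _ "M * n" "M * n"]) auto
  finally show ?thesis
    using l2_norm_fourier[OF Tv(2)] by simp
qed

text \<open>
  Transposition combined with the Fourier transform exchanges position and frequency, and with them
  the two cutoffs.
\<close>
lemma frequency_baker_swap_cutoffs:
  assumes n: "n > 0" and u: "u \<in> carrier_vec (M * n)" "l2_norm u = 1"
  obtains v where "v \<in> carrier_vec (M * n)" "l2_norm v = 1"
    "l2_norm (frequency_baker M \<A> \<beta> \<alpha> n *\<^sub>v v - \<mu> \<cdot>\<^sub>v v) \<le> l2_norm (frequency_baker M \<A> \<alpha> \<beta> n *\<^sub>v u - \<mu> \<cdot>\<^sub>v u)"
proof -
  obtain v where v: "v \<in> carrier_vec (M * n)" "l2_norm v = 1"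
    "l2_norm (transpose_mat (frequency_baker M \<A> \<alpha> \<beta> n) *\<^sub>v v - \<mu> \<cdot>\<^sub>v v)
      \<le> l2_norm (frequency_baker M \<A> \<alpha> \<beta> n *\<^sub>v u - \<mu> \<cdot>\<^sub>v u)"
    by (rule transpose_quasimode[OF frequency_baker_carrier u])
  have "fourier_mat (M * n) *\<^sub>v v \<in> carrier_vec (M * n)"
    using v(1) by (intro mult_mat_vec_carrier[of _ "M * n" "M * n"]) auto
  then show ?thesis
    using v l2_norm_fourier[OF v(1)] fourier_intertwines_transpose[OF n v(1)]
    by (intro that[of "fourier_mat (M * n) *\<^sub>v v"]) auto
qed

lemma baker_map_eq_transpose:
  assumes n: "n > 0" "M > 0" and fin: "finite \<A>"
  shows "baker_map M \<A> \<chi> (M * n) = transpose_mat (frequency_baker M \<A> \<chi> \<chi> n)"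
proof -
  let ?F = "fourier_mat (M * n)" and ?F' = "fourier_adj (M * n)" and ?T = "transpose_mat (frequency_baker M \<A> \<chi> \<chi> n)"
  have T: "?T \<in> carrier_mat (M * n) (M * n)" by simp
  have "baker_map M \<A> \<chi> (M * n) = ?F' * (?F * ?T)"
    unfolding baker_map_eq[OF n fin] fourier_frequency_baker_transpose[OF n(1)] ..
  also have "\<dots> = (?F' * ?F) * ?T"
    by (rule assoc_mult_mat[OF _ _ T, symmetric]) auto
  also have "\<dots> = ?T"
    unfolding fourier_adj_mult_fourier by (rule left_mult_one_mat[OF T])
  finally show ?thesis .
qed

section \<open>Smooth cutoffs and oscillatory sums\<close>

lemma iterated_deriv_differentiable:
  assumes "cutoff_function \<chi>"
  shows "((deriv ^^ n) \<chi> has_real_derivative (deriv ^^ Suc n) \<chi> x) (at x)"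
proof -
  have "(deriv ^^ n) \<chi> differentiable (at x)"
    using assms by (auto simp: cutoff_function_def differentiable_on_def)
  then show ?thesis
    by (simp add: DERIV_deriv_iff_real_differentiable)
qed

text \<open>
  All derivatives vanish on the open complement of the closed support. This is what lets the sum
  in the oscillatory estimate below be shifted without boundary terms.
\<close>
lemma cutoff_outside_unit_interval:
  assumes "cutoff_function \<chi>" "x \<notin> {0<..<1}"
  shows "(deriv ^^ n) \<chi> x = 0"
proof -
  let ?O = "- closure {x. \<chi> x \<noteq> 0}"
  have "open ?O" by (intro open_Compl closed_closure)
  have "\<forall>x\<in>?O. (deriv ^^ n) \<chi> x = 0"
  proof (induction n)
    case 0
    show ?case using closure_subset[of "{x. \<chi> x \<noteq> 0}"] by auto
  next
    case (Suc n)
    show ?case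
    proof
      fix x assume "x \<in> ?O"
      have "((deriv ^^ n) \<chi> has_real_derivative 0) (at x)"
      proof (rule has_field_derivative_transform_within_open[OF DERIV_const \<open>open ?O\<close> \<open>x \<in> ?O\<close>])
        show "0 = (deriv ^^ n) \<chi> y" if "y \<in> ?O" for y
          using bspec[OF Suc that] by (rule sym)
      qed
      then show "(deriv ^^ Suc n) \<chi> x = 0"
        by (simp add: DERIV_imp_deriv)
    qed
  qed
  moreover have "closure {x. \<chi> x \<noteq> 0} \<subseteq> {0<..<1}"
    using assms(1) unfolding cutoff_function_def by (elim conjE)
  then have "x \<in> ?O"
    using assms(2) by (meson ComplI subsetD)
  ultimately show ?thesis by blast
qed

lemma iterated_deriv_bounded:
  assumes "cutoff_function \<chi>"
  obtains B where "B \<ge> 0" "\<And>x. \<bar>(deriv ^^ n) \<chi> x\<bar> \<le> B"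
proof -
  have "continuous_on {0..1} ((deriv ^^ n) \<chi>)"
    using iterated_deriv_differentiable[OF assms]
    by (intro continuous_at_imp_continuous_on ballI DERIV_isCont) blast
  then have "bounded ((deriv ^^ n) \<chi> ` {0..1})"
    by (intro compact_imp_bounded compact_continuous_image) auto
  then obtain B where "\<forall>y\<in>(deriv ^^ n) \<chi> ` {0..1}. norm y \<le> B"
    unfolding bounded_iff by blast
  then have B: "\<bar>(deriv ^^ n) \<chi> x\<bar> \<le> B" if "x \<in> {0..1}" for x
    using that by simp
  have "\<bar>(deriv ^^ n) \<chi> x\<bar> \<le> \<bar>B\<bar>" for x
    using B[of x] cutoff_outside_unit_interval[OF assms, of x n] by (cases "x \<in> {0..1}") auto
  then show ?thesis by (intro that[of "\<bar>B\<bar>"]) auto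
qed

text \<open>
  Compactness of the support in the open interval. It prevents wrap-around on the circle: phases
  \<open>\<theta>\<close> close to \<open>\<pm>1\<close> would be as stationary as \<open>\<theta> = 0\<close>.
\<close>
lemma cutoff_support_away_from_endpoints:
  assumes "cutoff_function \<chi>"
  obtains c where "0 < c" "\<And>x. \<chi> x \<noteq> 0 \<Longrightarrow> c \<le> x \<and> x \<le> 1 - c"
proof -
  let ?S = "closure {x. \<chi> x \<noteq> 0}"
  have sub: "?S \<subseteq> {0<..<1}"
    using assms unfolding cutoff_function_def by (elim conjE)
  have S1: "compact ?S"
    using assms unfolding cutoff_function_def by (elim conjE)
  have "0 \<notin> ?S" "1 \<notin> ?S"
    using subsetD[OF sub, of 0] subsetD[OF sub, of 1] by auto
  then have S: "?S \<inter> {0, 1} = {}" by simp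
  have "closed {0, 1::real}" by simp
  from separate_compact_closed[OF S1 this S]
  obtain c where c: "c > 0" "\<forall>x\<in>?S. \<forall>y\<in>{0, 1}. c \<le> dist x y"
    by (elim exE conjE)
  have "c \<le> x \<and> x \<le> 1 - c" if "\<chi> x \<noteq> 0" for x
  proof -
    have x: "x \<in> ?S" using that closure_subset[of "{x. \<chi> x \<noteq> 0}"] by auto
    then have "x \<in> {0<..<1}" using sub by blast
    moreover have "c \<le> dist x 0" "c \<le> dist x 1"
      using bspec[OF c(2) x] by simp_all
    ultimately show ?thesis by (auto simp: dist_real_def)
  qed
  then show ?thesis using that c(1) by blast
qed

text \<open>
  Discrete nonstationary phase. Let \<open>F(t)\<close> be the sum. Shifting the summation index gives
  \<open>F(t + 1/n) = z F(t)\<close>, hence \<open>(z - 1) F(t) = F(t + 1/n) - F(t)\<close>. By the mean value inequality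
  this is at most \<open>1/n\<close> times the supremum of \<open>F'\<close>, and \<open>F'\<close> is, up to sign, the same sum for
  the next derivative of \<open>\<beta>\<close>. Each such step gains a factor \<open>1 / (n \<bar>z - 1\<bar>)\<close>.

  Each step also consumes a shift by \<open>1/n\<close>. The range of summation has \<open>K + 1\<close> extra terms and
  \<open>t\<close> is restricted to \<open>K - k\<close> shifts, so that after \<open>k \<le> K\<close> steps the index still covers the
  support of the translated function.
\<close>
lemma oscillatory_sum_bound:
  fixes z :: complex
  assumes \<beta>: "cutoff_function \<beta>" and z: "cmod z = 1" and n: "n > 0"
    and B: "\<And>x. \<bar>(deriv ^^ (m + k)) \<beta> x\<bar> \<le> B"
    and L: "L = n + K + 1" and t: "0 \<le> t" "t \<le> real (K - k) / real n" and k: "k \<le> K"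
  shows "cmod (z - 1) ^ k * cmod (\<Sum>l<L. of_real ((deriv ^^ m) \<beta> (real l / real n - t)) * z ^ l)
      \<le> real L * B / real n ^ k"
  using B t k
proof (induction k arbitrary: m t)
  case 0
  have "cmod (\<Sum>l<L. of_real ((deriv ^^ m) \<beta> (real l / real n - t)) * z ^ l) \<le> (\<Sum>l<L. B)"
    using 0 z by (intro order.trans[OF norm_sum] sum_mono) (auto simp: norm_mult norm_power)
  then show ?case by simp
next
  case (Suc k)
  define F where "F = (\<lambda>j t. \<Sum>l<L. complex_of_real ((deriv ^^ j) \<beta> (real l / real n - t)) * z ^ l)"
  have vanish: "(deriv ^^ m) \<beta> x = 0" if "x \<le> 0 \<or> 1 \<le> x" for x
    using cutoff_outside_unit_interval[OF \<beta>, of x m] that by auto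
  have shift: "F m (t + 1 / real n) = z * F m t"
  proof -
    have L': "L = Suc (n + K)" using L by simp
    have arg: "real (Suc l) / real n - (t + 1 / real n) = real l / real n - t" for l
      using n by (simp add: field_simps)
    have last: "(deriv ^^ m) \<beta> (real (n + K) / real n - t) = 0"
    proof (rule vanish)
      have "t \<le> real K / real n"
        using Suc.prems(3) by (rule order.trans) (intro divide_right_mono; simp)
      then show "real (n + K) / real n - t \<le> 0 \<or> 1 \<le> real (n + K) / real n - t"
        using n by (simp add: add_divide_distrib)
    qed
    have first: "(deriv ^^ m) \<beta> (real 0 / real n - (t + 1 / real n)) = 0"
    proof (rule vanish)
      have "0 \<le> t + 1 / real n" using Suc.prems(2) by simp
      then show "real 0 / real n - (t + 1 / real n) \<le> 0 \<or> 1 \<le> real 0 / real n - (t + 1 / real n)"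
        by simp
    qed
    \<comment> \<open>The terms lost at both ends of the shifted sum lie outside the support.\<close>
    define g where "g = (\<lambda>l. complex_of_real ((deriv ^^ m) \<beta> (real l / real n - t)))"
    define h where "h = (\<lambda>l. complex_of_real ((deriv ^^ m) \<beta> (real l / real n - (t + 1 / real n))) * z ^ l)"
    have "h 0 = 0" using first by (simp add: h_def)
    moreover have "h (Suc l) = z * (g l * z ^ l)" for l
      unfolding h_def g_def arg by simp
    moreover have "g (n + K) = 0" using last by (simp add: g_def)
    ultimately have "(\<Sum>l<L. h l) = z * (\<Sum>l<L. g l * z ^ l)"
      unfolding L' sum_distrib_left by (subst sum.lessThan_Suc_shift) simp
    then show ?thesis
      unfolding F_def g_def h_def .
  qed
  have diff: "F m (t + 1 / real n) - F m t = (z - 1) * F m t"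
    unfolding shift by (simp add: left_diff_distrib)
  have t': "t + 1 / real n \<le> real (K - k) / real n"
  proof -
    have K: "real (K - k) = real (K - Suc k) + 1" using Suc.prems(4) by linarith
    show ?thesis using Suc.prems(3) unfolding K add_divide_distrib by simp
  qed
  let ?w = "of_real (cmod (z - 1) ^ k) :: complex"
  have "cmod (?w * F m (t + 1 / real n) - ?w * F m t)
      \<le> real L * B / real n ^ k * norm ((t + 1 / real n) - t)"
  proof (rule differentiable_bound[of "{0..real (K - k) / real n}" "\<lambda>t. ?w * F m t" "\<lambda>s h. h *\<^sub>R (?w * (- F (Suc m) s))"])
    fix s assume s: "s \<in> {0..real (K - k) / real n}"
    have "((\<lambda>s. F m s) has_vector_derivative (\<Sum>l<L.
        of_real (- (deriv ^^ Suc m) \<beta> (real l / real n - s)) * z ^ l)) (at s within {0..real (K - k) / real n})"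
      unfolding F_def
    proof (intro has_vector_derivative_sum has_vector_derivative_mult_left has_vector_derivative_of_real)
      fix l
      have "((\<lambda>s. real l / real n - s) has_real_derivative - 1) (at s within {0..real (K - k) / real n})"
        by (auto intro!: derivative_eq_intros)
      from DERIV_chain2[OF iterated_deriv_differentiable[OF \<beta>] this, of m]
      show "((\<lambda>s. (deriv ^^ m) \<beta> (real l / real n - s)) has_real_derivative
          - (deriv ^^ Suc m) \<beta> (real l / real n - s)) (at s within {0..real (K - k) / real n})"
        unfolding mult_minus1_right .
    qed
    also have "(\<Sum>l<L. of_real (- (deriv ^^ Suc m) \<beta> (real l / real n - s)) * z ^ l) = - F (Suc m) s"
      unfolding F_def of_real_minus mult_minus_left sum_negf ..
    finally show "((\<lambda>s. ?w * F m s) has_derivative (\<lambda>h. h *\<^sub>R (?w * (- F (Suc m) s))))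
        (at s within {0..real (K - k) / real n})"
      unfolding has_vector_derivative_def[symmetric] by (rule has_vector_derivative_mult_right)
    have "cmod (?w * (- F (Suc m) s)) \<le> real L * B / real n ^ k"
    proof -
      have "cmod (?w * (- F (Suc m) s)) = cmod (z - 1) ^ k * cmod (F (Suc m) s)"
        unfolding norm_mult norm_minus_cancel by (simp add: norm_power)
      also have "\<dots> \<le> real L * B / real n ^ k"
        unfolding F_def using Suc.prems(1,4) s by (intro Suc.IH) auto
      finally show ?thesis .
    qed
    then show "onorm (\<lambda>h. h *\<^sub>R (?w * (- F (Suc m) s))) \<le> real L * B / real n ^ k"
      by (simp only: onorm_scaleR_left[OF bounded_linear_ident] onorm_id mult_1_left)
  next
    have "t \<le> t + 1 / real n" "0 \<le> t" using Suc.prems(2) by auto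
    then show "t + 1 / real n \<in> {0..real (K - k) / real n}" "t \<in> {0..real (K - k) / real n}"
      using t' by (auto intro: order.trans[OF _ t'])
  qed simp
  then have "cmod (z - 1) ^ k * cmod (F m (t + 1 / real n) - F m t) \<le> real L * B / real n ^ k * (1 / real n)"
    unfolding right_diff_distrib[symmetric] norm_mult by (simp add: norm_power)
  then have "cmod (z - 1) ^ k * (cmod (z - 1) * cmod (F m t)) \<le> real L * B / real n ^ k * (1 / real n)"
    unfolding diff norm_mult .
  then have "cmod (z - 1) ^ Suc k * cmod (F m t) \<le> real L * B / real n ^ Suc k"
    by (simp only: power_Suc mult_ac times_divide_eq_right mult_1_right divide_divide_eq_left)
  then show ?case
    unfolding F_def .
qed

text \<open>
  By compactness the bound is uniform in \<open>\<theta>\<close>; it controls the denominators \<open>\<bar>z - 1\<bar>\<close> of the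
  oscillatory estimate.
\<close>
lemma exp_minus_1_bounded_below:
  fixes c :: real
  assumes "0 < c"
  obtains \<kappa> :: real where "\<kappa> > 0"
    "\<And>\<theta>. c \<le> \<bar>\<theta>\<bar> \<Longrightarrow> \<bar>\<theta>\<bar> \<le> 1 - c \<Longrightarrow> \<kappa> \<le> cmod (exp (2 * of_real pi * \<i> * of_real \<theta>) - 1)"
proof -
  let ?f = "\<lambda>\<theta>::real. cmod (exp (2 * of_real pi * \<i> * of_real \<theta>) - 1)"
  let ?S = "{-(1 - c)..-c} \<union> {c..1 - c}"
  have f: "?f \<theta> > 0" if "\<theta> \<in> ?S" for \<theta>
  proof -
    have "exp (2 * of_real pi * \<i> * of_real \<theta>) \<noteq> (1::complex)"
    proof
      assume "exp (2 * of_real pi * \<i> * of_real \<theta>) = (1::complex)"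
      then obtain n :: int where "2 * pi * \<theta> = of_int (2 * n) * pi"
        by (auto simp: exp_eq_1)
      then have n: "\<theta> = of_int n" by simp
      have "\<bar>\<theta>\<bar> < 1" "\<theta> \<noteq> 0" using that assms by auto
      then show False using n by simp
    qed
    then show ?thesis by simp
  qed
  show ?thesis
  proof (cases "?S = {}")
    case True
    show ?thesis
    proof (rule that)
      show "0 < (1::real)" by simp
      fix \<theta> assume "c \<le> \<bar>\<theta>\<bar>" "\<bar>\<theta>\<bar> \<le> 1 - c"
      then have "\<theta> \<in> ?S" by auto
      then show "1 \<le> ?f \<theta>" unfolding True by blast
    qed
  next
    case False
    have S: "compact ?S" by (intro compact_Un compact_Icc)
    have cont: "continuous_on ?S ?f" by (intro continuous_intros)
    obtain x where x: "x \<in> ?S" "\<forall>y\<in>?S. ?f x \<le> ?f y"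
      using continuous_attains_inf[OF S False cont] by (rule bexE)
    show ?thesis
    proof (rule that)
      show "0 < ?f x" by (rule f[OF x(1)])
      fix \<theta> assume "c \<le> \<bar>\<theta>\<bar>" "\<bar>\<theta>\<bar> \<le> 1 - c"
      then have "\<theta> \<in> ?S" by auto
      then show "?f x \<le> ?f \<theta>" by (rule bspec[OF x(2)])
    qed
  qed
qed

section \<open>Stages of the Cantor set\<close>

definition cantor_stage :: "nat \<Rightarrow> nat set \<Rightarrow> nat \<Rightarrow> real set" where
  "cantor_stage M \<A> m = (\<Union>j\<in>cantor_digits M \<A> m. {real j / real M ^ m .. (real j + 1) / real M ^ m})"

lemma cantor_stage_0: "cantor_stage M \<A> 0 = {0..1}"
  by (auto simp: cantor_stage_def cantor_digits_def)

lemma cantor_digits_append_top: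
  assumes "j \<in> cantor_digits M \<A> m" "a \<in> \<A>"
  shows "j + a * M ^ m \<in> cantor_digits M \<A> (Suc m)"
proof -
  obtain d where d: "j = (\<Sum>i<m. d i * M ^ i)" "\<forall>i<m. d i \<in> \<A>"
    using assms(1) by (auto simp: cantor_digits_def)
  then have "j + a * M ^ m = (\<Sum>i<Suc m. (d(m := a)) i * M ^ i)"
    by simp
  then show ?thesis
    using d assms(2) unfolding cantor_digits_def by (auto simp: less_Suc_eq intro!: exI[of _ "d(m := a)"])
qed

text \<open>
  The stages are compatible with the inverse branches of the expanding map: a new leading digit \<open>a\<close>
  takes stage \<open>m\<close> into stage \<open>m + 1\<close>.
\<close>
lemma cantor_stage_preimage:
  assumes "M > 0" "a \<in> \<A>" "y \<in> cantor_stage M \<A> m"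
  shows "(real a + y) / real M \<in> cantor_stage M \<A> (Suc m)"
proof -
  obtain j where j: "j \<in> cantor_digits M \<A> m" "real j / real M ^ m \<le> y" "y \<le> (real j + 1) / real M ^ m"
    using assms(3) by (auto simp: cantor_stage_def)
  have "real (j + a * M ^ m) / real M ^ Suc m = (real a + real j / real M ^ m) / real M"
    "(real (j + a * M ^ m) + 1) / real M ^ Suc m = (real a + (real j + 1) / real M ^ m) / real M"
    using assms(1) by (simp_all add: field_simps)
  then have "real (j + a * M ^ m) / real M ^ Suc m \<le> (real a + y) / real M"
     "(real a + y) / real M \<le> (real (j + a * M ^ m) + 1) / real M ^ Suc m"
    using j by (auto intro!: divide_right_mono)
  then show ?thesis
    using cantor_digits_append_top[OF j(1) assms(2)] unfolding cantor_stage_def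
    by (auto simp del: of_nat_add power_Suc)
qed

text \<open>
  Refining an interval of stage \<open>m\<close> appends a last digit, so here the digit of index \<open>0\<close> is split
  off, in contrast to the leading digit above.
\<close>
lemma cantor_stage_Suc_subset:
  assumes "\<A> \<subseteq> {0..<M}"
  shows "cantor_stage M \<A> (Suc m) \<subseteq> cantor_stage M \<A> m"
proof
  fix x assume "x \<in> cantor_stage M \<A> (Suc m)"
  then obtain d where d: "\<forall>i<Suc m. d i \<in> \<A>"
    and x: "real (\<Sum>i<Suc m. d i * M ^ i) / real M ^ Suc m \<le> x"
      "x \<le> (real (\<Sum>i<Suc m. d i * M ^ i) + 1) / real M ^ Suc m"
    by (auto simp: cantor_stage_def cantor_digits_def)
  define j where "j = (\<Sum>i<m. d (Suc i) * M ^ i)"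
  have "d 0 < M" using d assms by auto
  then have M: "M > 0" "real (d 0) + 1 \<le> real M" by auto
  have sum: "real (\<Sum>i<Suc m. d i * M ^ i) = real (d 0) + real M * real j"
    unfolding j_def by (subst sum.lessThan_Suc_shift) (simp add: sum_distrib_left mult_ac)
  have "real j / real M ^ m = (real M * real j) / real M ^ Suc m"
    "(real j + 1) / real M ^ m = (real M * real j + real M) / real M ^ Suc m"
    using M by (simp_all add: field_simps)
  moreover have "(real M * real j) / real M ^ Suc m \<le> (real (d 0) + real M * real j) / real M ^ Suc m"
    "(real (d 0) + real M * real j + 1) / real M ^ Suc m \<le> (real M * real j + real M) / real M ^ Suc m"
    by (rule divide_right_mono; use M in simp)+
  ultimately have "real j / real M ^ m \<le> x" "x \<le> (real j + 1) / real M ^ m"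
    using x unfolding sum by linarith+
  moreover have "j \<in> cantor_digits M \<A> m"
    unfolding cantor_digits_def j_def using d by auto
  ultimately show "x \<in> cantor_stage M \<A> m"
    unfolding cantor_stage_def by auto
qed

lemma finite_cantor_digits:
  assumes "finite \<A>"
  shows "finite (cantor_digits M \<A> m)"
proof (induction m)
  case 0
  then show ?case by (simp add: cantor_digits_def)
next
  case (Suc m)
  have "cantor_digits M \<A> (Suc m) \<subseteq> (\<lambda>(j, a). j + a * M ^ m) ` (cantor_digits M \<A> m \<times> \<A>)"
  proof
    fix j assume "j \<in> cantor_digits M \<A> (Suc m)"
    then obtain d where "j = (\<Sum>i<Suc m. d i * M ^ i)" "\<forall>i<Suc m. d i \<in> \<A>"
      by (auto simp: cantor_digits_def)
    then have "j = (\<Sum>i<m. d i * M ^ i) + d m * M ^ m" "d m \<in> \<A>"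
      "(\<Sum>i<m. d i * M ^ i) \<in> cantor_digits M \<A> m"
      by (auto simp: cantor_digits_def)
    then show "j \<in> (\<lambda>(j, a). j + a * M ^ m) ` (cantor_digits M \<A> m \<times> \<A>)"
      by (intro image_eqI[of _ _ "(\<Sum>i<m. d i * M ^ i, d m)"]) auto
  qed
  then show ?case using Suc assms by (meson finite_SigmaI finite_imageI finite_subset)
qed

text \<open>
  The stages are compact and decrease to the Cantor set, so one of them is contained in \<open>U\<close>, and it
  has positive distance from the complement of \<open>U\<close>. The number of iterations in the localization
  argument is thus fixed independently of \<open>N\<close>.
\<close>
lemma cantor_stage_neighborhood:
  assumes \<A>: "\<A> \<subseteq> {0..<M}" and U: "open U" "cantor_limit M \<A> \<subseteq> U"
  obtains m \<delta> where "\<delta> > 0" "\<And>x y. y \<in> cantor_stage M \<A> m \<Longrightarrow> \<bar>x - y\<bar> < \<delta> \<Longrightarrow> x \<in> U"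
proof -
  have comp: "compact (cantor_stage M \<A> m)" for m
    unfolding cantor_stage_def using finite_cantor_digits[of \<A> M m] finite_subset[OF \<A>]
    by (intro compact_UN) auto
  have "\<exists>m. cantor_stage M \<A> m \<subseteq> U"
  proof (rule ccontr)
    assume "\<not> ?thesis"
    then have ne: "cantor_stage M \<A> m - U \<noteq> {}" for m by simp
    have anti: "cantor_stage M \<A> n \<subseteq> cantor_stage M \<A> m" if "m \<le> n" for m n
      using cantor_stage_Suc_subset[OF \<A>] that by (rule lift_Suc_antimono_le)
    have "\<Inter>(range (\<lambda>m. cantor_stage M \<A> m - U)) \<noteq> {}"
    proof (rule compact_nest)
      show "compact (cantor_stage M \<A> m - U)" for m
        by (rule compact_diff[OF comp U(1)])
      show "cantor_stage M \<A> n - U \<subseteq> cantor_stage M \<A> m - U" if "m \<le> n" for m n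
        using anti[OF that] by (rule Diff_mono) simp
    qed (rule ne)
    then obtain x where x: "\<And>m. x \<in> cantor_stage M \<A> m" "x \<notin> U" by fast
    then have "x \<in> cantor_limit M \<A>"
      unfolding cantor_limit_def cantor_stage_def[symmetric] by (intro INT_I)
    from subsetD[OF U(2) this] x(2) show False by (rule notE[rotated])
  qed
  then obtain m where m: "cantor_stage M \<A> m \<subseteq> U" by blast
  have cl: "closed (- U)" "cantor_stage M \<A> m \<inter> - U = {}" using U(1) m by (auto simp: closed_def)
  obtain \<delta> where "\<delta> > 0" "\<forall>y\<in>cantor_stage M \<A> m. \<forall>x\<in>- U. \<delta> \<le> dist y x"
    using separate_compact_closed[OF comp cl] by auto
  then show ?thesis
    by (intro that[of \<delta> m]) (force simp: dist_real_def abs_minus_commute)+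
qed

section \<open>Decay of the frequency kernel\<close>

text \<open>
  Summing over position inside the block of \<open>a = i div n\<close> leaves the exponential sum of \<open>\<beta>\<close> with
  phase \<open>q/N - p/n\<close>, where \<open>p = i mod n\<close>. Since \<open>i/N = (a + p/n)/M\<close>, the point \<open>p/n\<close> is the image
  of the output frequency \<open>i/N\<close> under the expanding map, and the phase is its distance from the
  input frequency \<open>q/N\<close>.
\<close>
lemma frequency_baker_index:
  assumes n: "n > 0" "M > 0" and ij: "i < M * n" "q < M * n"
  shows "frequency_baker M \<A> \<alpha> \<beta> n $$ (i, q) = (if i div n \<in> \<A> then
    of_real (\<alpha> (real (i mod n) / real n)) *
    ((\<Sum>l<n. of_real (\<beta> (real l / real n)) *
        exp (2 * of_real pi * \<i> * of_real (real q / real (M * n) - real (i mod n) / real n)) ^ l) *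
     exp (2 * of_real pi * \<i> * of_real (real (i div n * n) * real q / real (M * n))) /
       of_real (sqrt (real n) * sqrt (real (M * n)))) else 0)"
proof -
  let ?N = "M * n" and ?a = "i div n" and ?p = "i mod n"
  let ?H = "block_fourier_mat M \<A> \<alpha> \<beta> n"
  have "?a < M" using ij n by (simp add: less_mult_imp_div_less)
  then have an: "?a * n + n \<le> ?N"
    using mult_le_mono1[of "Suc ?a" M n] by simp
  have "frequency_baker M \<A> \<alpha> \<beta> n $$ (i, q) = (\<Sum>j\<in>{0..<?N}. ?H $$ (i, j) * fourier_adj ?N $$ (j, q))"
    using ij by (simp add: frequency_baker_def scalar_prod_def carrier_matD[OF block_fourier_mat_carrier])
  also have "\<dots> = (\<Sum>j\<in>(\<lambda>l. l + ?a * n) ` {..<n}. ?H $$ (i, j) * fourier_adj ?N $$ (j, q))"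
  proof (rule sum.mono_neutral_right)
    show "(\<lambda>l. l + ?a * n) ` {..<n} \<subseteq> {0..<?N}" using an by auto
    show "\<forall>j\<in>{0..<?N} - (\<lambda>l. l + ?a * n) ` {..<n}. ?H $$ (i, j) * fourier_adj ?N $$ (j, q) = 0"
    proof
      fix j assume j: "j \<in> {0..<?N} - (\<lambda>l. l + ?a * n) ` {..<n}"
      have "j div n \<noteq> ?a"
      proof
        assume "j div n = ?a"
        then have "j = j mod n + ?a * n" using div_mult_mod_eq[of j n] by simp
        moreover have "j mod n \<in> {..<n}" using n by simp
        ultimately show False using j by blast
      qed
      then show "?H $$ (i, j) * fourier_adj ?N $$ (j, q) = 0"
        using ij j by (auto simp: block_fourier_mat_def)
    qed
  qed simp
  also have "\<dots> = (\<Sum>l<n. ?H $$ (i, l + ?a * n) * fourier_adj ?N $$ (l + ?a * n, q))"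
    by (subst sum.reindex) (auto intro: inj_onI)
  also have "\<dots> = (\<Sum>l<n. if ?a \<in> \<A> then of_real (\<alpha> (real ?p / real n)) *
     (of_real (\<beta> (real l / real n)) *
        exp (2 * of_real pi * \<i> * of_real (real q / real ?N - real ?p / real n)) ^ l *
     exp (2 * of_real pi * \<i> * of_real (real (?a * n) * real q / real ?N)) /
       of_real (sqrt (real n) * sqrt (real ?N))) else 0)"
  proof (intro sum.cong refl)
    fix l assume l: "l \<in> {..<n}"
    have e: "exp (- 2 * of_real pi * \<i> * of_nat ?p * of_nat l / of_nat n) *
        exp (2 * of_real pi * \<i> * of_nat (l + ?a * n) * of_nat q / of_nat ?N)
      = exp (2 * of_real pi * \<i> * of_real (real q / real ?N - real ?p / real n)) ^ l *
        exp (2 * of_real pi * \<i> * of_real (real (?a * n) * real q / real ?N))"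
      unfolding exp_of_nat_mult[symmetric] mult_exp_exp
      by (rule arg_cong[of _ _ exp]) (use n in \<open>simp add: field_simps\<close>)
    have H: "?H $$ (i, l + ?a * n) = (if ?a \<in> \<A> then of_real (\<alpha> (real ?p / real n)) *
        fourier_mat n $$ (?p, l) * of_real (\<beta> (real l / real n)) else 0)"
      using ij l an n by (simp add: block_fourier_mat_def)
    define Z E D where "Z = exp (2 * of_real pi * \<i> * of_real (real q / real ?N - real ?p / real n))"
      and "E = exp (2 * of_real pi * \<i> * of_real (real (?a * n) * real q / real ?N))"
      and "D = complex_of_real (sqrt (real n) * sqrt (real ?N))"
    have F: "fourier_mat n $$ (?p, l) * fourier_adj ?N $$ (l + ?a * n, q) = Z ^ l * E / D"
      unfolding Z_def E_def D_def e[symmetric] using l an n ij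
      by (subst fourier_mat_index, simp, simp, subst fourier_adj_index) simp_all
    have xy: "x * f * y * f' = x * (y * Z ^ l * E / D)" if "f * f' = Z ^ l * E / D" for x y f f' :: complex
    proof -
      have "x * f * y * f' = x * (y * (f * f'))" by (simp only: mult_ac)
      then show ?thesis unfolding that by (simp only: times_divide_eq_right mult.assoc)
    qed
    show "?H $$ (i, l + ?a * n) * fourier_adj ?N $$ (l + ?a * n, q) = (if ?a \<in> \<A> then of_real (\<alpha> (real ?p / real n)) *
     (of_real (\<beta> (real l / real n)) *
        exp (2 * of_real pi * \<i> * of_real (real q / real ?N - real ?p / real n)) ^ l *
     exp (2 * of_real pi * \<i> * of_real (real (?a * n) * real q / real ?N)) /
       of_real (sqrt (real n) * sqrt (real ?N))) else 0)"
      unfolding H Z_def[symmetric] E_def[symmetric] D_def[symmetric] using xy[OF F]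
      by (cases "?a \<in> \<A>") (simp_all only: if_True if_False mult_zero_left)
  qed
  also have "\<dots> = (if ?a \<in> \<A> then
    of_real (\<alpha> (real ?p / real n)) *
    ((\<Sum>l<n. of_real (\<beta> (real l / real n)) *
        exp (2 * of_real pi * \<i> * of_real (real q / real ?N - real ?p / real n)) ^ l) *
     exp (2 * of_real pi * \<i> * of_real (real (?a * n) * real q / real ?N)) /
       of_real (sqrt (real n) * sqrt (real ?N))) else 0)"
    by (auto simp: sum_distrib_left sum_distrib_right sum_divide_distrib)
  finally show ?thesis .
qed
lemma cutoff_function_range:
  assumes "cutoff_function \<chi>"
  shows "\<bar>\<chi> x\<bar> \<le> 1"
proof -
  have "\<chi> x \<in> {0..1}"
    using assms rangeI[of \<chi> x] unfolding cutoff_function_def by (elim conjE) (rule subsetD)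
  then show ?thesis by simp
qed

lemma frequency_baker_norm_le:
  assumes n: "n > 0" "M > 0" and ij: "i < M * n" "q < M * n"
  shows "cmod (frequency_baker M \<A> \<alpha> \<beta> n $$ (i, q)) \<le> \<bar>\<alpha> (real (i mod n) / real n)\<bar> *
    cmod (\<Sum>l<n. of_real (\<beta> (real l / real n)) *
        exp (2 * of_real pi * \<i> * of_real (real q / real (M * n) - real (i mod n) / real n)) ^ l) / real n"
    (is "_ \<le> \<bar>?a\<bar> * cmod ?S / _")
proof -
  have "1 * real n \<le> real M * real n" using n by (intro mult_right_mono) auto
  then have "sqrt (real n) \<le> sqrt (real (M * n))" by simp
  then have "sqrt (real n) * sqrt (real n) \<le> sqrt (real n) * sqrt (real (M * n))"
    by (intro mult_left_mono) auto
  then have D: "real n \<le> sqrt (real n) * sqrt (real (M * n))"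
    by simp
  have E: "cmod (exp (2 * of_real pi * \<i> * of_real r)) = 1" for r :: real
    by simp
  show ?thesis
  proof (cases "i div n \<in> \<A>")
    case True
    have "cmod (frequency_baker M \<A> \<alpha> \<beta> n $$ (i, q))
        = \<bar>?a\<bar> * cmod ?S / (sqrt (real n) * sqrt (real (M * n)))"
      unfolding frequency_baker_index[OF n ij] if_P[OF True] norm_mult norm_divide norm_of_real E
      by simp
    also have "\<dots> \<le> \<bar>?a\<bar> * cmod ?S / real n"
      using D n by (intro divide_left_mono) auto
    finally show ?thesis .
  next
    case False
    show ?thesis unfolding frequency_baker_index[OF n ij] if_not_P[OF False] by simp
  qed
qed

lemma frequency_baker_entry_le_1:
  assumes \<alpha>: "cutoff_function \<alpha>" and \<beta>: "cutoff_function \<beta>"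
    and n: "n > 0" "M > 0" and ij: "i < M * n" "q < M * n"
  shows "cmod (frequency_baker M \<A> \<alpha> \<beta> n $$ (i, q)) \<le> 1"
proof -
  have "cmod (\<Sum>l<n. of_real (\<beta> (real l / real n)) *
      exp (2 * of_real pi * \<i> * of_real (real q / real (M * n) - real (i mod n) / real n)) ^ l)
    \<le> (\<Sum>l<n. 1)"
    by (intro order.trans[OF norm_sum] sum_mono)
      (simp add: norm_mult norm_power cutoff_function_range[OF \<beta>])
  then have "\<bar>\<alpha> (real (i mod n) / real n)\<bar> * cmod (\<Sum>l<n. of_real (\<beta> (real l / real n)) *
        exp (2 * of_real pi * \<i> * of_real (real q / real (M * n) - real (i mod n) / real n)) ^ l)
      \<le> 1 * real n"
    by (intro mult_mono cutoff_function_range[OF \<alpha>]) auto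
  then have "\<bar>\<alpha> (real (i mod n) / real n)\<bar> * cmod (\<Sum>l<n. of_real (\<beta> (real l / real n)) *
        exp (2 * of_real pi * \<i> * of_real (real q / real (M * n) - real (i mod n) / real n)) ^ l) / real n
      \<le> 1"
    using n by (simp add: divide_le_eq)
  with frequency_baker_norm_le[OF n ij, of \<A> \<alpha> \<beta>] show ?thesis by (rule order.trans)
qed

text \<open>
  Propagation of frequencies: the input frequency \<open>q/N\<close> contributes to the output frequency \<open>i/N\<close>
  only if the expanding map takes the latter close to the former. The cutoff \<open>\<alpha>\<close> keeps \<open>p/n\<close> away
  from \<open>0\<close> and \<open>1\<close>, which makes closeness on the interval and on the circle the same. The constant
  does not depend on the size of the matrix.
\<close>
lemma frequency_baker_off_diagonal_decay:
  assumes \<alpha>: "cutoff_function \<alpha>" and \<beta>: "cutoff_function \<beta>" and \<delta>: "\<delta> > 0"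
  obtains C where "C \<ge> 0"
    "\<And>M \<A> n i q. \<lbrakk>n > 0; M > 0; i < M * n; q < M * n;
       \<delta> \<le> \<bar>real q / real (M * n) - real (i mod n) / real n\<bar>\<rbrakk>
     \<Longrightarrow> cmod (frequency_baker M \<A> \<alpha> \<beta> n $$ (i, q)) \<le> C / real n ^ K"
proof -
  obtain c where c: "0 < c" "\<And>x. \<alpha> x \<noteq> 0 \<Longrightarrow> c \<le> x \<and> x \<le> 1 - c"
    by (rule cutoff_support_away_from_endpoints[OF \<alpha>]) blast
  obtain B where B: "B \<ge> 0" "\<And>x. \<bar>(deriv ^^ K) \<beta> x\<bar> \<le> B"
    by (rule iterated_deriv_bounded[OF \<beta>]) blast
  have "0 < min c \<delta>" using c \<delta> by simp
  then obtain \<kappa> where \<kappa>: "\<kappa> > 0"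
    "\<And>\<theta>. min c \<delta> \<le> \<bar>\<theta>\<bar> \<Longrightarrow> \<bar>\<theta>\<bar> \<le> 1 - min c \<delta> \<Longrightarrow>
       \<kappa> \<le> cmod (exp (2 * of_real pi * \<i> * of_real \<theta>) - 1)"
    using exp_minus_1_bounded_below by blast
  define C where "C = (real K + 2) * B / \<kappa> ^ K"
  have C0: "C \<ge> 0" using B \<kappa> by (simp add: C_def)
  show ?thesis
  proof (rule that[OF C0])
    fix M \<A> n i q
    assume n: "n > (0::nat)" "M > 0" and ij: "i < M * n" "q < M * n"
      and far: "\<delta> \<le> \<bar>real q / real (M * n) - real (i mod n) / real n\<bar>"
    let ?\<theta> = "real q / real (M * n) - real (i mod n) / real n"
    let ?z = "exp (2 * of_real pi * \<i> * of_real ?\<theta>)"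
    let ?S = "\<Sum>l<n. of_real (\<beta> (real l / real n)) * ?z ^ l"
    let ?a = "\<alpha> (real (i mod n) / real n)"
    have le: "\<bar>?a\<bar> * cmod ?S / real n \<le> C / real n ^ K"
    proof (cases "?a = 0")
      case True
      then show ?thesis using C0 by simp
    next
      case False
      have q: "0 \<le> real q / real (M * n)" "real q / real (M * n) \<le> 1"
        using ij n by (simp_all add: divide_le_eq_1 del: of_nat_mult)
      have "\<bar>?\<theta>\<bar> \<le> 1 - c"
        using c(2)[OF False] q by linarith
      then have z: "\<kappa> \<le> cmod (?z - 1)"
        using far by (intro \<kappa>(2)) auto
      have z1: "cmod ?z = 1" by simp
      let ?L = "n + K + 1"
      have tail: "?S = (\<Sum>l<?L. of_real ((deriv ^^ 0) \<beta> (real l / real n - 0)) * ?z ^ l)"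
      proof (rule sum.mono_neutral_cong_left)
        show "\<forall>l\<in>{..<?L} - {..<n}. of_real ((deriv ^^ 0) \<beta> (real l / real n - 0)) * ?z ^ l = 0"
        proof
          fix l assume "l \<in> {..<?L} - {..<n}"
          then have "real l / real n - 0 \<notin> {0<..<1}" using n by auto
          then show "of_real ((deriv ^^ 0) \<beta> (real l / real n - 0)) * ?z ^ l = 0"
            using cutoff_outside_unit_interval[OF \<beta>, of "real l / real n - 0" 0] by simp
        qed
      qed auto
      have "cmod (?z - 1) ^ K * cmod ?S \<le> real ?L * B / real n ^ K"
        unfolding tail by (rule oscillatory_sum_bound[OF \<beta> z1 n(1), of 0 K B ?L K 0]) (use B in auto)
      moreover have "\<kappa> ^ K * cmod ?S \<le> cmod (?z - 1) ^ K * cmod ?S"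
        using z \<kappa> by (intro mult_right_mono power_mono) auto
      moreover have "real ?L * B / real n ^ K \<le> ((real K + 2) * real n) * B / real n ^ K"
      proof (intro divide_right_mono mult_right_mono)
        have "real K * 1 \<le> real K * real n" using n by (intro mult_left_mono) auto
        moreover have "1 \<le> real n" using n by simp
        ultimately show "real ?L \<le> (real K + 2) * real n" by (simp add: distrib_right)
      qed (use B in auto)
      ultimately have "\<kappa> ^ K * cmod ?S \<le> (real K + 2) * real n * B / real n ^ K"
        by linarith
      then have S: "cmod ?S / real n \<le> C / real n ^ K"
        using \<kappa> n by (simp add: C_def field_simps)
      have "\<bar>?a\<bar> * (cmod ?S / real n) \<le> 1 * (cmod ?S / real n)"
        by (intro mult_right_mono cutoff_function_range[OF \<alpha>]) auto
      then show ?thesis using S by simp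
    qed
    show "cmod (frequency_baker M \<A> \<alpha> \<beta> n $$ (i, q)) \<le> C / real n ^ K"
      using frequency_baker_norm_le[OF n ij, of \<A> \<alpha> \<beta>] le by (rule order.trans)
  qed
qed

text \<open>
  If \<open>u\<close> is of size \<open>\<eta>\<close> at frequencies away from \<open>T\<close>, its image is small at output frequencies
  which the expanding map takes away from \<open>T\<close>: inputs near \<open>T\<close> are suppressed by the decay of the
  kernel, the others by \<open>\<eta>\<close>. The two radii \<open>\<delta>\<close> and \<open>2 * \<delta>\<close> leave the gap \<open>\<delta>\<close> that the decay
  requires. The loss of a factor \<open>N\<close> is harmless against arbitrary powers.
\<close>
lemma frequency_baker_apply_away:
  assumes \<alpha>: "cutoff_function \<alpha>" and \<beta>: "cutoff_function \<beta>" and \<delta>: "\<delta> > 0"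
  obtains C where "C \<ge> 0"
    "\<And>M \<A> n i u T \<eta>. \<lbrakk>n > 0; M > 0; i < M * n; u \<in> carrier_vec (M * n); \<eta> \<ge> 0;
       \<And>q. q < M * n \<Longrightarrow> cmod (u $ q) \<le> 1;
       \<And>q. q < M * n \<Longrightarrow> (\<And>y. y \<in> T \<Longrightarrow> \<delta> \<le> \<bar>real q / real (M * n) - y\<bar>) \<Longrightarrow> cmod (u $ q) \<le> \<eta>;
       \<And>y. y \<in> T \<Longrightarrow> 2 * \<delta> \<le> \<bar>real (i mod n) / real n - y\<bar>\<rbrakk>
     \<Longrightarrow> cmod ((frequency_baker M \<A> \<alpha> \<beta> n *\<^sub>v u) $ i) \<le> real (M * n) * (C / real n ^ K + \<eta>)"
proof -
  obtain C where C: "C \<ge> 0"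
    "\<And>M \<A> n i q. \<lbrakk>n > 0; M > 0; i < M * n; q < M * n;
       \<delta> \<le> \<bar>real q / real (M * n) - real (i mod n) / real n\<bar>\<rbrakk>
     \<Longrightarrow> cmod (frequency_baker M \<A> \<alpha> \<beta> n $$ (i, q)) \<le> C / real n ^ K"
    by (rule frequency_baker_off_diagonal_decay[OF assms, of K]) blast
  show ?thesis
  proof (rule that[OF C(1)])
    fix M \<A> n i u T \<eta>
    assume n: "n > 0" "M > 0" and i: "i < M * n" and u: "u \<in> carrier_vec (M * n)" and \<eta>: "\<eta> \<ge> 0"
      and u1: "\<And>q. q < M * n \<Longrightarrow> cmod (u $ q) \<le> 1"
      and small: "\<And>q. q < M * n \<Longrightarrow> (\<And>y. y \<in> T \<Longrightarrow> \<delta> \<le> \<bar>real q / real (M * n) - y\<bar>) \<Longrightarrow> cmod (u $ q) \<le> \<eta>"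
      and far: "\<And>y. y \<in> T \<Longrightarrow> 2 * \<delta> \<le> \<bar>real (i mod n) / real n - y\<bar>"
    let ?G = "frequency_baker M \<A> \<alpha> \<beta> n"
    have Cn: "0 \<le> C / real n ^ K" using C(1) by simp
    have "(?G *\<^sub>v u) $ i = (\<Sum>q\<in>{0..<M * n}. ?G $$ (i, q) * u $ q)"
      using i u carrier_matD[OF frequency_baker_carrier[of M \<A> \<alpha> \<beta> n]] by (simp add: scalar_prod_def)
    also have "cmod \<dots> \<le> (\<Sum>q\<in>{0..<M * n}. C / real n ^ K + \<eta>)"
    proof (intro order.trans[OF norm_sum] sum_mono)
      fix q assume "q \<in> {0..<M * n}"
      then have q: "q < M * n" by simp
      show "cmod (?G $$ (i, q) * u $ q) \<le> C / real n ^ K + \<eta>"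
      proof (cases "\<forall>y\<in>T. \<delta> \<le> \<bar>real q / real (M * n) - y\<bar>")
        case True
        then have "cmod (u $ q) \<le> \<eta>" using small[OF q] by blast
        then have "cmod (?G $$ (i, q)) * cmod (u $ q) \<le> 1 * \<eta>"
          using frequency_baker_entry_le_1[OF \<alpha> \<beta> n i q] by (intro mult_mono) auto
        then show ?thesis using Cn by (simp add: norm_mult)
      next
        case False
        then obtain y where y: "y \<in> T" "\<bar>real q / real (M * n) - y\<bar> < \<delta>" by force
        then have "\<delta> \<le> \<bar>real q / real (M * n) - real (i mod n) / real n\<bar>"
          using far[OF y(1)] by linarith
        then have "cmod (?G $$ (i, q)) * cmod (u $ q) \<le> C / real n ^ K * 1"
          using C(2)[OF n i q] u1[OF q] Cn by (intro mult_mono) auto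
        then show ?thesis using \<eta> by (simp add: norm_mult)
      qed
    qed
    finally show "cmod ((?G *\<^sub>v u) $ i) \<le> real (M * n) * (C / real n ^ K + \<eta>)"
      by simp
  qed
qed

lemma frequency_baker_row_cong:
  assumes n: "n > 0" "M > 0" and i: "i < M * n" and u: "u \<in> carrier_vec (M * n)"
    and "i div n \<notin> \<A> \<or> \<alpha> (real (i mod n) / real n) = \<alpha>' (real (i mod n) / real n)"
  shows "(frequency_baker M \<A> \<alpha> \<beta> n *\<^sub>v u) $ i = (frequency_baker M \<A> \<alpha>' \<beta> n *\<^sub>v u) $ i"
proof -
  have "frequency_baker M \<A> \<alpha> \<beta> n $$ (i, q) = frequency_baker M \<A> \<alpha>' \<beta> n $$ (i, q)" if "q < M * n" for q
    unfolding frequency_baker_index[OF n i that] using assms(5) by auto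
  then show ?thesis
    using i u carrier_matD[OF frequency_baker_carrier[of M \<A> \<alpha> \<beta> n]]
      carrier_matD[OF frequency_baker_carrier[of M \<A> \<alpha>' \<beta> n]]
    by (simp add: scalar_prod_def)
qed

lemma frequency_baker_row_outside_alphabet:
  assumes n: "n > 0" "M > 0" and i: "i < M * n" and u: "u \<in> carrier_vec (M * n)"
    and "i div n \<notin> \<A>"
  shows "(frequency_baker M \<A> \<alpha> \<beta> n *\<^sub>v u) $ i = 0"
proof -
  have "frequency_baker M \<A> \<alpha> \<beta> n $$ (i, q) = 0" if "q < M * n" for q
    unfolding frequency_baker_index[OF n i that] using assms(5) by auto
  then show ?thesis
    using i u carrier_matD[OF frequency_baker_carrier[of M \<A> \<alpha> \<beta> n]]
    by (simp add: scalar_prod_def)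
qed

section \<open>Localization and change of the outer cutoff\<close>

text \<open>
  Induction on the stage, using \<open>\<mu> u = B u\<close> up to the residual. An output frequency in the block of
  \<open>a \<in> \<A>\<close> at distance \<open>\<delta>\<close> from stage \<open>m + 1\<close> is mapped to a point at distance
  \<open>M * \<delta> \<ge> 2 * \<delta>\<close> from stage \<open>m\<close>, because the inverse branches contract by \<open>M\<close>; the same \<open>\<delta>\<close>
  therefore serves at all stages. In blocks of other letters \<open>B u\<close> vanishes. At stage \<open>0\<close> there
  are no frequencies to consider. Each step costs a factor \<open>N\<close> and a division by \<open>\<mu>\<close>, which the
  lower bound \<open>\<Lambda>\<close> makes uniform.
\<close>
lemma quasimode_localization:
  assumes \<alpha>: "cutoff_function \<alpha>" and \<beta>: "cutoff_function \<beta>" and \<delta>: "\<delta> > 0"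
    and M: "M \<ge> 2" and \<Lambda>: "\<Lambda> > 0"
  shows "\<exists>c\<ge>0. \<forall>n \<mu> u \<epsilon>. n > 0 \<longrightarrow> \<Lambda> \<le> cmod \<mu> \<longrightarrow> u \<in> carrier_vec (M * n) \<longrightarrow> l2_norm u = 1 \<longrightarrow>
    l2_norm (frequency_baker M \<A> \<alpha> \<beta> n *\<^sub>v u - \<mu> \<cdot>\<^sub>v u) \<le> \<epsilon> \<longrightarrow>
    (\<forall>q<M * n. (\<forall>y\<in>cantor_stage M \<A> m. \<delta> \<le> \<bar>real q / real (M * n) - y\<bar>) \<longrightarrow>
      cmod (u $ q) \<le> c * real (M * n) ^ m * (\<epsilon> + 1 / real (M * n) ^ K))"
proof (induction m)
  case 0
  show ?case
  proof (intro exI[of _ 0] conjI allI impI)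
    fix n q :: nat and u :: "complex vec"
    assume "n > 0" "q < M * n"
      and far: "\<forall>y\<in>cantor_stage M \<A> 0. \<delta> \<le> \<bar>real q / real (M * n) - y\<bar>"
    then have "real q / real (M * n) \<in> cantor_stage M \<A> 0"
      using M by (auto simp: cantor_stage_0 divide_le_eq_1 simp del: of_nat_mult)
    from bspec[OF far this] \<delta> show "cmod (u $ q) \<le> 0 * real (M * n) ^ 0 * (\<epsilon> + 1 / real (M * n) ^ K)" for \<epsilon>
      by simp
  qed simp
next
  case (Suc m)
  then obtain c where c0: "c \<ge> 0" and c: "\<And>n \<mu> u \<epsilon> q. \<lbrakk>n > 0; \<Lambda> \<le> cmod \<mu>; u \<in> carrier_vec (M * n); l2_norm u = 1;
    l2_norm (frequency_baker M \<A> \<alpha> \<beta> n *\<^sub>v u - \<mu> \<cdot>\<^sub>v u) \<le> \<epsilon>; q < M * n;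
    \<forall>y\<in>cantor_stage M \<A> m. \<delta> \<le> \<bar>real q / real (M * n) - y\<bar>\<rbrakk> \<Longrightarrow>
      cmod (u $ q) \<le> c * real (M * n) ^ m * (\<epsilon> + 1 / real (M * n) ^ K)"
    by metis
  obtain C where C0: "C \<ge> 0" and C: "\<And>M \<A> n i u T \<eta>. \<lbrakk>n > 0; M > 0; i < M * n; u \<in> carrier_vec (M * n); \<eta> \<ge> 0;
       \<And>q. q < M * n \<Longrightarrow> cmod (u $ q) \<le> 1;
       \<And>q. q < M * n \<Longrightarrow> (\<And>y. y \<in> T \<Longrightarrow> \<delta> \<le> \<bar>real q / real (M * n) - y\<bar>) \<Longrightarrow> cmod (u $ q) \<le> \<eta>;
       \<And>y. y \<in> T \<Longrightarrow> 2 * \<delta> \<le> \<bar>real (i mod n) / real n - y\<bar>\<rbrakk>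
     \<Longrightarrow> cmod ((frequency_baker M \<A> \<alpha> \<beta> n *\<^sub>v u) $ i) \<le> real (M * n) * (C / real n ^ K + \<eta>)"
    by (rule frequency_baker_apply_away[OF \<alpha> \<beta> \<delta>, of K]) blast
  define c' where "c' = (C * real M ^ K + c + 1) / \<Lambda>"
  show ?case
  proof (intro exI[of _ c'] conjI allI impI)
    show "c' \<ge> 0" using C0 c0 \<Lambda> by (simp add: c'_def)
    fix n \<mu> u \<epsilon> i
    assume n: "n > (0::nat)" and \<mu>: "\<Lambda> \<le> cmod \<mu>" and u: "u \<in> carrier_vec (M * n)" "l2_norm u = 1"
      and res: "l2_norm (frequency_baker M \<A> \<alpha> \<beta> n *\<^sub>v u - \<mu> \<cdot>\<^sub>v u) \<le> \<epsilon>" and i: "i < M * n"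
      and far: "\<forall>y\<in>cantor_stage M \<A> (Suc m). \<delta> \<le> \<bar>real i / real (M * n) - y\<bar>"
    let ?G = "frequency_baker M \<A> \<alpha> \<beta> n" and ?N = "real (M * n)"
    define \<omega> where "\<omega> = \<epsilon> + 1 / ?N ^ K"
    have M0: "M > 0" using M by simp
    have N1: "1 \<le> ?N" using n M0 by (simp add: Suc_leI del: of_nat_mult)
    have \<epsilon>: "\<epsilon> \<ge> 0" using res l2_norm_nonneg order.trans by blast
    have \<omega>: "0 \<le> \<omega>" "\<epsilon> \<le> \<omega>" "1 / ?N ^ K \<le> \<omega>" using \<epsilon> by (auto simp: \<omega>_def)
    have Gu: "?G *\<^sub>v u \<in> carrier_vec (M * n)" "?G *\<^sub>v u - \<mu> \<cdot>\<^sub>v u \<in> carrier_vec (M * n)"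
      using u residual_carrier[OF u(1)] by (auto intro!: mult_mat_vec_carrier[of _ "M * n" "M * n"])
    have G: "cmod ((?G *\<^sub>v u) $ i) \<le> ?N * (C / real n ^ K + c * ?N ^ m * \<omega>)"
    proof (cases "i div n \<in> \<A>")
      case True
      have "2 * \<delta> \<le> \<bar>real (i mod n) / real n - y\<bar>" if y: "y \<in> cantor_stage M \<A> m" for y
      proof -
        have "real i = real (i div n) * real n + real (i mod n)"
          unfolding of_nat_mult[symmetric] of_nat_add[symmetric] by simp
        then have "real i / ?N - (real (i div n) + y) / real M = (real (i mod n) / real n - y) / real M"
          using n M0 by (simp add: field_simps)
        moreover have "\<delta> \<le> \<bar>real i / ?N - (real (i div n) + y) / real M\<bar>"
          using far cantor_stage_preimage[OF M0 True y] by blast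
        ultimately have "\<delta> \<le> \<bar>real (i mod n) / real n - y\<bar> / real M"
          by simp
        then have "real M * \<delta> \<le> \<bar>real (i mod n) / real n - y\<bar>"
          using M0 by (simp add: field_simps)
        moreover have "2 * \<delta> \<le> real M * \<delta>" using M \<delta> by (intro mult_right_mono) auto
        ultimately show ?thesis by linarith
      qed
      then show ?thesis
        using u i n M0 \<omega>(1) c0 cmod_index_le_l2_norm[OF u(1)] c[OF n \<mu> u res]
        by (intro C[where T = "cantor_stage M \<A> m"]) (auto simp: \<omega>_def)
    next
      case False
      then show ?thesis
        using frequency_baker_row_outside_alphabet[OF n M0 i u(1) False] C0 c0 \<omega>(1) by simp
    qed
    have "C / real n ^ K = C * real M ^ K * (1 / ?N ^ K)"
      using M0 by (simp add: power_mult_distrib)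
    also have "\<dots> \<le> C * real M ^ K * \<omega>"
      using \<omega> C0 by (intro mult_left_mono) auto
    also have "\<dots> \<le> C * real M ^ K * \<omega> * ?N ^ m"
      using mult_left_mono[OF one_le_power[OF N1, of m], of "C * real M ^ K * \<omega>"] \<omega> C0 by simp
    finally have CK: "C / real n ^ K \<le> C * real M ^ K * ?N ^ m * \<omega>" by (simp add: mult_ac)
    have "\<mu> * u $ i = (?G *\<^sub>v u) $ i - (?G *\<^sub>v u - \<mu> \<cdot>\<^sub>v u) $ i"
      using i u Gu by simp
    then have "cmod (\<mu> * u $ i) \<le> cmod ((?G *\<^sub>v u) $ i) + cmod ((?G *\<^sub>v u - \<mu> \<cdot>\<^sub>v u) $ i)"
      by (metis norm_triangle_ineq4)
    also have "\<dots> \<le> ?N * (C / real n ^ K + c * ?N ^ m * \<omega>) + \<omega>"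
      using G cmod_index_le_l2_norm[OF Gu(2) i] res \<omega> by linarith
    also have "\<dots> \<le> ?N * (C * real M ^ K * ?N ^ m * \<omega> + c * ?N ^ m * \<omega>) + ?N ^ Suc m * \<omega>"
    proof (intro add_mono mult_left_mono CK order.refl)
      have "1 * \<omega> \<le> ?N ^ Suc m * \<omega>" using N1 \<omega> by (intro mult_right_mono one_le_power) auto
      then show "\<omega> \<le> ?N ^ Suc m * \<omega>" by simp
    qed (use c0 in \<open>auto intro!: mult_nonneg_nonneg\<close>)
    also have "\<dots> = \<Lambda> * (c' * ?N ^ Suc m * \<omega>)"
      using \<Lambda> by (simp add: c'_def field_simps)
    finally have "cmod \<mu> * cmod (u $ i) \<le> \<Lambda> * (c' * ?N ^ Suc m * \<omega>)"
      by (simp add: norm_mult)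
    moreover have "\<Lambda> * cmod (u $ i) \<le> cmod \<mu> * cmod (u $ i)"
      using \<mu> by (intro mult_right_mono) auto
    ultimately have "\<Lambda> * cmod (u $ i) \<le> \<Lambda> * (c' * ?N ^ Suc m * \<omega>)" by linarith
    then show "cmod (u $ i) \<le> c' * ?N ^ Suc m * (\<epsilon> + 1 / ?N ^ K)"
      using \<Lambda> by (simp add: \<omega>_def)
  qed
qed
text \<open>
  The two matrices differ only in rows with \<open>p/n\<close> outside \<open>U\<close>, hence far from a suitable stage of
  the Cantor set, and there both images of the localized vector \<open>u\<close> are small. The power \<open>P\<close> is
  chosen before \<open>K\<close>, so that a rapidly decreasing residual \<open>\<epsilon>\<close> gives a rapidly decreasing residual.
\<close>
lemma outer_cutoff_change:
  assumes \<A>: "\<A> \<subseteq> {0..<M}" and M: "M \<ge> 2"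
    and \<alpha>: "cutoff_function \<alpha>" and \<alpha>': "cutoff_function \<alpha>'" and \<beta>: "cutoff_function \<beta>"
    and U: "open U" "cantor_limit M \<A> \<subseteq> U" "\<And>x. x \<in> U \<Longrightarrow> \<alpha> x = \<alpha>' x"
    and \<Lambda>: "\<Lambda> > 0"
  shows "\<exists>P. \<forall>K. \<exists>C\<ge>0. \<forall>n \<mu> u \<epsilon>. n > 0 \<longrightarrow> \<Lambda> \<le> cmod \<mu> \<longrightarrow> u \<in> carrier_vec (M * n) \<longrightarrow> l2_norm u = 1 \<longrightarrow>
       l2_norm (frequency_baker M \<A> \<alpha> \<beta> n *\<^sub>v u - \<mu> \<cdot>\<^sub>v u) \<le> \<epsilon> \<longrightarrow>
     l2_norm (frequency_baker M \<A> \<alpha>' \<beta> n *\<^sub>v u - \<mu> \<cdot>\<^sub>v u)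
       \<le> C * real (M * n) ^ P * (\<epsilon> + 1 / real (M * n) ^ K)"
proof -
  obtain m \<delta>' where \<delta>': "\<delta>' > 0"
    and near: "\<And>x y. y \<in> cantor_stage M \<A> m \<Longrightarrow> \<bar>x - y\<bar> < \<delta>' \<Longrightarrow> x \<in> U"
    by (rule cantor_stage_neighborhood[OF \<A> U(1,2)]) blast
  define \<delta> where "\<delta> = \<delta>' / 2"
  have \<delta>: "\<delta> > 0" using \<delta>' by (simp add: \<delta>_def)
  have M0: "M > 0" using M by simp
  have "\<exists>C\<ge>0. \<forall>n \<mu> u \<epsilon>. n > 0 \<longrightarrow> \<Lambda> \<le> cmod \<mu> \<longrightarrow> u \<in> carrier_vec (M * n) \<longrightarrow> l2_norm u = 1 \<longrightarrow>
       l2_norm (frequency_baker M \<A> \<alpha> \<beta> n *\<^sub>v u - \<mu> \<cdot>\<^sub>v u) \<le> \<epsilon> \<longrightarrow>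
     l2_norm (frequency_baker M \<A> \<alpha>' \<beta> n *\<^sub>v u - \<mu> \<cdot>\<^sub>v u)
       \<le> C * real (M * n) ^ (m + 2) * (\<epsilon> + 1 / real (M * n) ^ K)" for K
  proof -
    obtain c where c0: "c \<ge> 0" and c: "\<And>n \<mu> u \<epsilon> q. \<lbrakk>n > 0; \<Lambda> \<le> cmod \<mu>; u \<in> carrier_vec (M * n); l2_norm u = 1;
      l2_norm (frequency_baker M \<A> \<alpha> \<beta> n *\<^sub>v u - \<mu> \<cdot>\<^sub>v u) \<le> \<epsilon>; q < M * n;
      \<forall>y\<in>cantor_stage M \<A> m. \<delta> \<le> \<bar>real q / real (M * n) - y\<bar>\<rbrakk> \<Longrightarrow>
        cmod (u $ q) \<le> c * real (M * n) ^ m * (\<epsilon> + 1 / real (M * n) ^ K)"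
      using quasimode_localization[OF \<alpha> \<beta> \<delta> M \<Lambda>, of \<A> m K] by metis
    obtain C1 where C1: "C1 \<ge> 0" "\<And>M \<A> n i u T \<eta>. \<lbrakk>n > 0; M > 0; i < M * n; u \<in> carrier_vec (M * n); \<eta> \<ge> 0;
         \<And>q. q < M * n \<Longrightarrow> cmod (u $ q) \<le> 1;
         \<And>q. q < M * n \<Longrightarrow> (\<And>y. y \<in> T \<Longrightarrow> \<delta> \<le> \<bar>real q / real (M * n) - y\<bar>) \<Longrightarrow> cmod (u $ q) \<le> \<eta>;
         \<And>y. y \<in> T \<Longrightarrow> 2 * \<delta> \<le> \<bar>real (i mod n) / real n - y\<bar>\<rbrakk>
       \<Longrightarrow> cmod ((frequency_baker M \<A> \<alpha> \<beta> n *\<^sub>v u) $ i) \<le> real (M * n) * (C1 / real n ^ K + \<eta>)"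
      by (rule frequency_baker_apply_away[OF \<alpha> \<beta> \<delta>, of K]) blast
    obtain C2 where C2: "C2 \<ge> 0" "\<And>M \<A> n i u T \<eta>. \<lbrakk>n > 0; M > 0; i < M * n; u \<in> carrier_vec (M * n); \<eta> \<ge> 0;
         \<And>q. q < M * n \<Longrightarrow> cmod (u $ q) \<le> 1;
         \<And>q. q < M * n \<Longrightarrow> (\<And>y. y \<in> T \<Longrightarrow> \<delta> \<le> \<bar>real q / real (M * n) - y\<bar>) \<Longrightarrow> cmod (u $ q) \<le> \<eta>;
         \<And>y. y \<in> T \<Longrightarrow> 2 * \<delta> \<le> \<bar>real (i mod n) / real n - y\<bar>\<rbrakk>
       \<Longrightarrow> cmod ((frequency_baker M \<A> \<alpha>' \<beta> n *\<^sub>v u) $ i) \<le> real (M * n) * (C2 / real n ^ K + \<eta>)"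
      by (rule frequency_baker_apply_away[OF \<alpha>' \<beta> \<delta>, of K]) blast
    define C where "C = (C1 + C2) * real M ^ K + 2 * c + 1"
    show ?thesis
    proof (intro exI[of _ C] conjI allI impI)
      show "C \<ge> 0" using C1(1) C2(1) c0 by (simp add: C_def)
      fix n \<mu> u \<epsilon>
      assume n: "n > (0::nat)" and \<mu>: "\<Lambda> \<le> cmod \<mu>" and u: "u \<in> carrier_vec (M * n)" "l2_norm u = 1"
        and res: "l2_norm (frequency_baker M \<A> \<alpha> \<beta> n *\<^sub>v u - \<mu> \<cdot>\<^sub>v u) \<le> \<epsilon>"
      let ?G = "frequency_baker M \<A> \<alpha> \<beta> n" and ?G' = "frequency_baker M \<A> \<alpha>' \<beta> n" and ?N = "real (M * n)"
      define \<omega> where "\<omega> = \<epsilon> + 1 / ?N ^ K"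
      have N1: "1 \<le> ?N" using n M0 by (simp add: Suc_leI del: of_nat_mult)
      have \<epsilon>: "\<epsilon> \<ge> 0" using res l2_norm_nonneg order.trans by blast
      have \<omega>: "0 \<le> \<omega>" "\<epsilon> \<le> \<omega>" "1 / ?N ^ K \<le> \<omega>" using \<epsilon> by (auto simp: \<omega>_def)
      have Gu: "?G *\<^sub>v u \<in> carrier_vec (M * n)" "?G' *\<^sub>v u \<in> carrier_vec (M * n)"
        "?G *\<^sub>v u - \<mu> \<cdot>\<^sub>v u \<in> carrier_vec (M * n)" "?G' *\<^sub>v u - \<mu> \<cdot>\<^sub>v u \<in> carrier_vec (M * n)"
        using u residual_carrier[OF u(1)] by (auto intro!: mult_mat_vec_carrier[of _ "M * n" "M * n"])
      define D where "D = ?N * (C1 / real n ^ K + c * ?N ^ m * \<omega>) + ?N * (C2 / real n ^ K + c * ?N ^ m * \<omega>)"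
      have D0: "D \<ge> 0" using C1(1) C2(1) c0 \<omega> by (auto simp: D_def intro!: add_nonneg_nonneg mult_nonneg_nonneg)
      have diff: "cmod ((?G' *\<^sub>v u) $ i - (?G *\<^sub>v u) $ i) \<le> D" if i: "i < M * n" for i
      proof (cases "i div n \<notin> \<A> \<or> \<alpha>' (real (i mod n) / real n) = \<alpha> (real (i mod n) / real n)")
        case True
        from frequency_baker_row_cong[where \<alpha> = \<alpha>' and \<alpha>' = \<alpha>, OF n M0 i u(1) this] D0 show ?thesis by simp
      next
        case False
        then have nU: "real (i mod n) / real n \<notin> U" using U(3) by metis
        have far: "2 * \<delta> \<le> \<bar>real (i mod n) / real n - y\<bar>" if "y \<in> cantor_stage M \<A> m" for y
          using near[OF that, of "real (i mod n) / real n"] nU by (force simp: \<delta>_def)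
        have \<eta>: "0 \<le> c * ?N ^ m * \<omega>" using c0 \<omega> by simp
        have u1: "cmod (u $ q) \<le> 1" if "q < M * n" for q
          using cmod_index_le_l2_norm[OF u(1) that] u(2) by simp
        have small: "cmod (u $ q) \<le> c * ?N ^ m * \<omega>" if "q < M * n"
          "\<And>y. y \<in> cantor_stage M \<A> m \<Longrightarrow> \<delta> \<le> \<bar>real q / ?N - y\<bar>" for q
          unfolding \<omega>_def using c[OF n \<mu> u res that(1)] that(2) by blast
        have "cmod ((?G *\<^sub>v u) $ i) \<le> ?N * (C1 / real n ^ K + c * ?N ^ m * \<omega>)"
          by (rule C1(2)[OF n M0 i u(1) \<eta> u1 small far])
        moreover have "cmod ((?G' *\<^sub>v u) $ i) \<le> ?N * (C2 / real n ^ K + c * ?N ^ m * \<omega>)"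
          by (rule C2(2)[OF n M0 i u(1) \<eta> u1 small far])
        ultimately show ?thesis
          unfolding D_def using norm_triangle_ineq4[of "(?G' *\<^sub>v u) $ i" "(?G *\<^sub>v u) $ i"] by linarith
      qed
      have "l2_norm (?G' *\<^sub>v u - \<mu> \<cdot>\<^sub>v u) \<le> ?N * (D + \<epsilon>)"
      proof (rule l2_norm_le_sup[OF Gu(4)])
        fix i assume i: "i < M * n"
        have "(?G' *\<^sub>v u - \<mu> \<cdot>\<^sub>v u) $ i = ((?G' *\<^sub>v u) $ i - (?G *\<^sub>v u) $ i) + (?G *\<^sub>v u - \<mu> \<cdot>\<^sub>v u) $ i"
          using i u Gu by simp
        then have "cmod ((?G' *\<^sub>v u - \<mu> \<cdot>\<^sub>v u) $ i)
            \<le> cmod ((?G' *\<^sub>v u) $ i - (?G *\<^sub>v u) $ i) + cmod ((?G *\<^sub>v u - \<mu> \<cdot>\<^sub>v u) $ i)"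
          by (metis norm_triangle_ineq)
        then show "cmod ((?G' *\<^sub>v u - \<mu> \<cdot>\<^sub>v u) $ i) \<le> D + \<epsilon>"
          using diff[OF i] cmod_index_le_l2_norm[OF Gu(3) i] res by linarith
      qed
      also have "\<dots> \<le> ?N * (C * ?N ^ Suc m * \<omega>)"
      proof (rule mult_left_mono)
        have Nm: "1 \<le> ?N ^ m" using N1 by (rule one_le_power)
        have NSm: "1 \<le> ?N ^ Suc m" using N1 by (rule one_le_power)
        have nK: "B / real n ^ K \<le> B * real M ^ K * \<omega> * ?N ^ m" if "B \<ge> 0" for B
        proof -
          have "B / real n ^ K = B * real M ^ K * (1 / ?N ^ K)"
            using M0 by (simp add: power_mult_distrib)
          also have "\<dots> \<le> B * real M ^ K * \<omega>"
            using \<omega> that by (intro mult_left_mono) auto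
          also have "\<dots> \<le> B * real M ^ K * \<omega> * ?N ^ m"
            using mult_left_mono[OF Nm, of "B * real M ^ K * \<omega>"] \<omega> that by simp
          finally show ?thesis .
        qed
        have "1 * \<omega> \<le> ?N ^ Suc m * \<omega>" using NSm \<omega> by (intro mult_right_mono) auto
        then have "D + \<epsilon> \<le> ?N * (C1 * real M ^ K * \<omega> * ?N ^ m + c * ?N ^ m * \<omega>)
            + ?N * (C2 * real M ^ K * \<omega> * ?N ^ m + c * ?N ^ m * \<omega>) + ?N ^ Suc m * \<omega>"
          unfolding D_def using \<omega>(2) nK[OF C1(1)] nK[OF C2(1)]
          by (intro add_mono mult_left_mono) (auto intro!: mult_nonneg_nonneg simp: c0)
        also have "\<dots> = C * ?N ^ Suc m * \<omega>"
          by (simp add: C_def algebra_simps)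
        finally show "D + \<epsilon> \<le> C * ?N ^ Suc m * \<omega>" .
      qed simp
      also have "\<dots> = C * ?N ^ (m + 2) * (\<epsilon> + 1 / ?N ^ K)"
        by (simp add: \<omega>_def)
      finally show "l2_norm (?G' *\<^sub>v u - \<mu> \<cdot>\<^sub>v u) \<le> C * ?N ^ (m + 2) * (\<epsilon> + 1 / ?N ^ K)" .
    qed
  qed
  then show ?thesis by blast
qed

section \<open>Quasimodes for a modified cutoff\<close>

theorem theorem4:
  fixes M :: nat and \<A> :: "nat set" and \<chi> \<chi>' :: "real \<Rightarrow> real" and \<nu> :: real
  assumes "\<A> \<subseteq> {0..<M}" and "1 < card \<A>" and "card \<A> < M"
    and "cutoff_function \<chi>" and "cutoff_function \<chi>'"
    and "\<exists>U. open U \<and> cantor_limit M \<A> \<subseteq> U \<and> (\<forall>x\<in>U. \<chi> x = \<chi>' x)"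
    and "0 \<le> \<nu>"
  shows "\<exists>C :: nat \<Rightarrow> real. \<forall>k\<ge>1. \<forall>\<mu>.
    eigenvalue (baker_map M \<A> \<chi> (M ^ k)) \<mu> \<and> real M powr (- \<nu>) \<le> cmod \<mu> \<longrightarrow>
    (\<exists>v\<in>carrier_vec (M ^ k).
       l2_norm v = 1 \<and>
       (\<forall>n. l2_norm (baker_map M \<A> \<chi>' (M ^ k) *\<^sub>v v - \<mu> \<cdot>\<^sub>v v) \<le> C n * real (M ^ k) powr (- real n)))"
proof -
  have M: "M \<ge> 2" "M > 0" using assms(2,3) by auto
  have fin: "finite \<A>" using assms(1) by (rule finite_subset) simp
  have \<Lambda>: "real M powr (- \<nu>) > 0" using M by simp
  obtain U where U: "open U" "cantor_limit M \<A> \<subseteq> U" "\<And>x. x \<in> U \<Longrightarrow> \<chi> x = \<chi>' x"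
    using assms(6) by blast
  obtain P1 C1 where C1: "\<And>K. C1 K \<ge> 0"
    "\<And>K n \<mu> u \<epsilon>. \<lbrakk>n > 0; real M powr (- \<nu>) \<le> cmod \<mu>; u \<in> carrier_vec (M * n); l2_norm u = 1;
       l2_norm (frequency_baker M \<A> \<chi> \<chi> n *\<^sub>v u - \<mu> \<cdot>\<^sub>v u) \<le> \<epsilon>\<rbrakk> \<Longrightarrow>
     l2_norm (frequency_baker M \<A> \<chi>' \<chi> n *\<^sub>v u - \<mu> \<cdot>\<^sub>v u) \<le> C1 K * real (M * n) ^ P1 * (\<epsilon> + 1 / real (M * n) ^ K)"
    using outer_cutoff_change[OF assms(1) M(1) assms(4,5,4) U \<Lambda>] by metis
  obtain P2 C2 where C2: "\<And>K. C2 K \<ge> 0"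
    "\<And>K n \<mu> u \<epsilon>. \<lbrakk>n > 0; real M powr (- \<nu>) \<le> cmod \<mu>; u \<in> carrier_vec (M * n); l2_norm u = 1;
       l2_norm (frequency_baker M \<A> \<chi> \<chi>' n *\<^sub>v u - \<mu> \<cdot>\<^sub>v u) \<le> \<epsilon>\<rbrakk> \<Longrightarrow>
     l2_norm (frequency_baker M \<A> \<chi>' \<chi>' n *\<^sub>v u - \<mu> \<cdot>\<^sub>v u) \<le> C2 K * real (M * n) ^ P2 * (\<epsilon> + 1 / real (M * n) ^ K)"
    using outer_cutoff_change[OF assms(1) M(1) assms(4,5,5) U \<Lambda>] by metis
  \<comment> \<open>The exponents compensate for the factors \<open>N ^ P1\<close> and \<open>N ^ P2\<close> lost in the two steps.\<close>
  define C where "C r = C2 (r + P2) * (C1 (r + P2 + P1) + 1)" for r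
  show ?thesis
  proof (intro exI[of _ C] allI impI)
    fix k :: nat and \<mu> :: complex
    assume k: "1 \<le> k"
      and ev: "eigenvalue (baker_map M \<A> \<chi> (M ^ k)) \<mu> \<and> real M powr (- \<nu>) \<le> cmod \<mu>"
    define n where "n = M ^ (k - 1)"
    have Mk: "M ^ k = M * n" unfolding n_def using k by (cases k) auto
    have n: "n > 0" using M by (simp add: n_def)
    let ?N = "real (M * n)"
    have N1: "1 \<le> ?N" using n M by (simp add: Suc_leI del: of_nat_mult)
    let ?F = "fourier_mat (M * n)"
    obtain w where w: "w \<in> carrier_vec (M * n)" "w \<noteq> 0\<^sub>v (M * n)"
      "baker_map M \<A> \<chi> (M * n) *\<^sub>v w = \<mu> \<cdot>\<^sub>v w"
      using ev carrier_matD(1)[OF baker_map_carrier[of M \<A> \<chi> "M * n"]]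
      unfolding eigenvalue_def eigenvector_def Mk by auto
    obtain c where c: "c \<noteq> 0" "l2_norm (c \<cdot>\<^sub>v w) = 1"
      by (rule exists_unit_vector_on_line[OF w(1,2)])
    define w1 where "w1 = c \<cdot>\<^sub>v w"
    have w1: "w1 \<in> carrier_vec (M * n)" "l2_norm w1 = 1"
      using w c by (auto simp: w1_def)
    have "baker_map M \<A> \<chi> (M * n) *\<^sub>v w1 - \<mu> \<cdot>\<^sub>v w1 = 0\<^sub>v (M * n)"
      unfolding w1_def mult_mat_vec[OF baker_map_carrier w(1)] w(3)
      using w(1) by (intro eq_vecI) auto
    then have "l2_norm (baker_map M \<A> \<chi> (M * n) *\<^sub>v w1 - \<mu> \<cdot>\<^sub>v w1) = 0"
      using l2_norm_eq_0_iff[of "0\<^sub>v (M * n)" "M * n"] by simp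
    then have u1: "l2_norm (frequency_baker M \<A> \<chi> \<chi> n *\<^sub>v (?F *\<^sub>v w1) - \<mu> \<cdot>\<^sub>v (?F *\<^sub>v w1)) \<le> 0"
      unfolding fourier_intertwines_transpose[OF n w1(1)] baker_map_eq_transpose[OF n M(2) fin] by simp
    have F: "?F *\<^sub>v w1 \<in> carrier_vec (M * n)" "l2_norm (?F *\<^sub>v w1) = 1"
      using w1 l2_norm_fourier[OF w1(1)] by (auto intro!: mult_mat_vec_carrier[of _ "M * n" "M * n"])
    have \<mu>: "real M powr (- \<nu>) \<le> cmod \<mu>" using ev by simp
    \<comment> \<open>The residual itself, not one of its bounds: the next vector must not depend on the exponent.\<close>
    define \<epsilon> where "\<epsilon> = l2_norm (frequency_baker M \<A> \<chi>' \<chi> n *\<^sub>v (?F *\<^sub>v w1) - \<mu> \<cdot>\<^sub>v (?F *\<^sub>v w1))"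
    have \<epsilon>: "\<epsilon> \<le> C1 K * ?N ^ P1 * (0 + 1 / ?N ^ K)" for K
      unfolding \<epsilon>_def by (rule C1(2)[OF n \<mu> F u1])
    obtain u where u: "u \<in> carrier_vec (M * n)" "l2_norm u = 1"
      "l2_norm (frequency_baker M \<A> \<chi> \<chi>' n *\<^sub>v u - \<mu> \<cdot>\<^sub>v u) \<le> \<epsilon>"
      unfolding \<epsilon>_def by (rule frequency_baker_swap_cutoffs[OF n F])
    obtain v where v: "v \<in> carrier_vec (M * n)" "l2_norm v = 1"
      "l2_norm (transpose_mat (frequency_baker M \<A> \<chi>' \<chi>' n) *\<^sub>v v - \<mu> \<cdot>\<^sub>v v)
        \<le> l2_norm (frequency_baker M \<A> \<chi>' \<chi>' n *\<^sub>v u - \<mu> \<cdot>\<^sub>v u)"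
      by (rule transpose_quasimode[OF frequency_baker_carrier u(1,2)])
    have bound: "l2_norm (baker_map M \<A> \<chi>' (M * n) *\<^sub>v v - \<mu> \<cdot>\<^sub>v v) \<le> C r * ?N powr (- real r)" for r
    proof -
      let ?K = "r + P2"
      have "l2_norm (baker_map M \<A> \<chi>' (M * n) *\<^sub>v v - \<mu> \<cdot>\<^sub>v v)
          \<le> l2_norm (frequency_baker M \<A> \<chi>' \<chi>' n *\<^sub>v u - \<mu> \<cdot>\<^sub>v u)"
        using v(3) by (simp add: baker_map_eq_transpose[OF n M(2) fin])
      also have "\<dots> \<le> C2 ?K * ?N ^ P2 * (\<epsilon> + 1 / ?N ^ ?K)"
        by (rule C2(2)[OF n \<mu> u])
      also have "\<dots> \<le> C2 ?K * ?N ^ P2 * ((C1 (?K + P1) + 1) / ?N ^ ?K)"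
      proof (rule mult_left_mono)
        have "\<epsilon> \<le> C1 (?K + P1) / ?N ^ ?K"
          using \<epsilon>[of "?K + P1"] n M by (simp add: power_add)
        then show "\<epsilon> + 1 / ?N ^ ?K \<le> (C1 (?K + P1) + 1) / ?N ^ ?K"
          by (simp add: add_divide_distrib)
      qed (use C2(1) in simp)
      also have "\<dots> = C r / ?N ^ r"
        using n M by (simp add: C_def power_add)
      also have "\<dots> = C r * ?N powr (- real r)"
        using N1 by (simp add: powr_minus powr_realpow divide_inverse del: of_nat_mult)
      finally show ?thesis .
    qed
    show "\<exists>v\<in>carrier_vec (M ^ k). l2_norm v = 1 \<and>
       (\<forall>r. l2_norm (baker_map M \<A> \<chi>' (M ^ k) *\<^sub>v v - \<mu> \<cdot>\<^sub>v v) \<le> C r * real (M ^ k) powr (- real r))"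
      unfolding Mk using v(1,2) bound by blast
  qed
qed

end
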